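(* Let $n\geq 0$ be an integer and let $k\geq 1$, $n_1,\dots,n_k\geq 1$, $t_1,\dots,t_k\geq 1$ be integers satisfying one of the following conditions: 1) $k=1$, $n=0$, $n_1\geq t_1+1$; 2) ($n\geq 1$ or $k\geq 2$), $n_j\geq t_j$ for all $j=1,\dots,k$, and $n+\sum_{j=1}^{k}n_j\geq \sum_{j=1}^{k}t_j+2$. Let $a$ and $b$ be two finite nonzero complex values and let $f$ be a nonconstant entire function on $\mathbb{C}$. If $$f^{n+n_1+\dots+n_k}-a \rightleftharpoons f^n(f^{n_1})^{(t_1)}\cdots(f^{n_k})^{(t_k)}-b,$$ i.e. these two functions have the same zeros counting multiplicity, then there is a nonzero constant $c$ such that $$\frac{f^n(f^{n_1})^{(t_1)}\cdots(f^{n_k})^{(t_k)}-b}{f^{n+n_1+\dots+n_k}-a}=c$$ identically. In particular, if $a=b$, then $f(z)=c_1e^{tz}$, where $c_1$ and $t$ are nonzero constants and $t$ satisfies $(tn_1)^{t_1}\cdots(tn_k)^{t_k}=1$.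
   Context: $(f^{m})^{(t)}$ denotes the $t$-th derivative of the power $f^m$. For meromorphic functions $F,G$ on $\mathbb{C}$ and complex numbers $a,b$, the notation $F-a\rightleftharpoons G-b$ means that $F-a$ and $G-b$ have the same zeros and the same poles, counting multiplicity (for entire functions there are no poles). *)

theory Defs
  imports "HOL-Complex_Analysis.Complex_Analysis"
begin

(* For meromorphic F, G: the same zeros and the same poles, with multiplicities.
   Zeros are described by limits, so that the relation depends on F and G only as
   meromorphic functions and not on the value that the formalization assigns to them
   at poles or removable singularities; for entire F the limit condition at z means
   F z = 0. zorder is the multiplicity at a zero and minus the multiplicity at a pole. *)
definition same_zeros_poles :: "(complex \<Rightarrow> complex) \<Rightarrow> (complex \<Rightarrow> complex) \<Rightarrow> bool"
    (infix "\<rightleftharpoons>" 50) where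
  "F \<rightleftharpoons> G \<longleftrightarrow>
     (\<forall>z. (F \<midarrow>z\<rightarrow> 0 \<longleftrightarrow> G \<midarrow>z\<rightarrow> 0) \<and> (is_pole F z \<longleftrightarrow> is_pole G z) \<and>
          (F \<midarrow>z\<rightarrow> 0 \<or> is_pole F z \<longrightarrow> zorder F z = zorder G z))"

definition diff_monomial ::
  "nat \<Rightarrow> nat \<Rightarrow> (nat \<Rightarrow> nat) \<Rightarrow> (nat \<Rightarrow> nat) \<Rightarrow> (complex \<Rightarrow> complex) \<Rightarrow> complex \<Rightarrow> complex" where
  "diff_monomial n k ns ts f z =
     f z ^ n * (\<Prod>j=1..k. (deriv ^^ ts j) (\<lambda>w. f w ^ ns j) z)"

end

(* Write F = f^N with N = n + sum n_j, and M for the differential monomial.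

   If f' were unbounded on the level set |f| = 1, Zalcman's rescaling, carried out on that level set,
   would produce a nonconstant entire limit g of exponential type. Since M is rescaled by a factor
   tending to 0, in the limit g^N = a would hold exactly where M(g) = 0. As M(g) vanishes at the zeros
   of g, there are none, so g is an exponential and M(g) is a nonzero multiple of g^N, which is absurd.

   A bound for f' on |f| = 1 makes log |f|, where positive, grow at most linearly with the distance:
   it is a positive harmonic function on the largest disc around a point on which |f| > 1, and its
   gradient at a boundary point on |f| = 1 controls its value at the centre. Hence the translates of f,
   divided by max 1 |f|, form a normal family. For the zero-free entire function E = (M - b) / (F - a)
   normality bounds E' on |E| = 1, so by the same growth estimate E = exp (alpha z + beta).

   Suppose alpha is not 0. As M is divisible by f, so is a E - b = E F - M, and
   Q = (f' / f) (E - b / a) is entire. By normality Q is bounded, hence constant, and letting E tend to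
   infinity shows Q = alpha b / (N a). Letting E tend to 0 gives a limit g of translates with
   g' = - (a Q / b) g and M(g) constant, a contradiction. *)
theory Submission
  imports Defs
begin

subsection \<open>Growth of functions with a derivative bound on a level set\<close>

text \<open>Both \<open>f^N\<close> and M are homogeneous of degree N in f, so f may be divided by a
  large constant without losing the equation \<open>M - b = E (F - a)\<close>: a and b merely
  acquire a factor \<open>s^N\<close>. The obstacle is that a limit g of normalised translates may
  satisfy \<open>g^N = a s^N\<close> identically, and then the limit equation says nothing about E.
  In that case g is a nonzero constant with M(g) = 0, and the rate at which F - a tends to 0 has to
  be compared with the growth of E. Q is built from f'/f because its poles, the zeros of f, lie
  where E = b/a. The factor E - b/a removes them, and it behaves like E where E is large and like
  -b/a where E is small. A constant Q therefore carries information from the half-plane where E is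
  large, in which f is nearly constant, to the one where E is small, in which it forces f'/f to be
  close to -\<alpha>/N. There f would look like a nonconstant exponential although M is nearly the
  constant b.\<close>

lemma Re_mul_eq_norm_diff:
  "4 * Re x * Re y = (cmod (x + cnj y))\<^sup>2 - (cmod (x - y))\<^sup>2"
  unfolding cmod_power2 by (simp add: power2_eq_square algebra_simps)

text \<open>Schwarz's lemma for \<open>\<phi>\<close> followed by the Cayley map of the right
  half-plane that sends \<open>\<phi> z\<close> to 0. The first part is the gradient bound at the
  centre, the second Harnack's lower bound, for the positive harmonic function Re \<phi>.\<close>

lemma positive_real_part_Schwarz:
  assumes holo: "\<phi> holomorphic_on ball z d" and d: "d > 0"
    and pos: "\<And>w. w \<in> ball z d \<Longrightarrow> Re (\<phi> w) > 0"
  shows "cmod (deriv \<phi> z) \<le> 2 * Re (\<phi> z) / d"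
    and "w \<in> ball z d \<Longrightarrow> Re (\<phi> w) \<ge> Re (\<phi> z) * (d - dist z w) / (d + dist z w)"
proof -
  define A where "A = (\<lambda>\<zeta>::complex. of_real d * \<zeta> + z)"
  define q where "q = (\<lambda>\<zeta>. (\<phi> (A \<zeta>) - \<phi> z) / (\<phi> (A \<zeta>) + cnj (\<phi> z)))"
  have A: "A \<zeta> \<in> ball z d" if "\<zeta> \<in> ball 0 1" for \<zeta>
    using that d by (simp add: A_def dist_norm norm_mult)
  have zb: "z \<in> ball z d" and u0: "Re (\<phi> z) > 0" using d pos by auto
  have hA: "A holomorphic_on ball 0 1" unfolding A_def by (intro holomorphic_intros)
  have hpA: "(\<lambda>\<zeta>. \<phi> (A \<zeta>)) holomorphic_on ball 0 1"
    using holomorphic_on_compose_gen[OF hA holo] A by (simp add: o_def image_subset_iff)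
  have den: "\<phi> (A \<zeta>) + cnj (\<phi> z) \<noteq> 0" if "\<zeta> \<in> ball 0 1" for \<zeta>
  proof -
    have "Re (\<phi> (A \<zeta>) + cnj (\<phi> z)) > 0" using pos[OF A[OF that]] u0 by simp
    then show ?thesis by (metis less_irrefl zero_complex.sel(1))
  qed
  have hq: "q holomorphic_on ball 0 1"
    unfolding q_def by (intro holomorphic_intros hpA den)
  have q0: "q 0 = 0" by (simp add: q_def A_def)
  have q1: "cmod (q \<zeta>) < 1" if "cmod \<zeta> < 1" for \<zeta>
  proof -
    have zb': "\<zeta> \<in> ball 0 1" using that by simp
    have "0 < 4 * Re (\<phi> (A \<zeta>)) * Re (\<phi> z)" using pos[OF A[OF zb']] u0 by simp
    then have "(cmod (\<phi> (A \<zeta>) - \<phi> z))\<^sup>2 < (cmod (\<phi> (A \<zeta>) + cnj (\<phi> z)))\<^sup>2"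
      unfolding Re_mul_eq_norm_diff by simp
    then have "cmod (\<phi> (A \<zeta>) - \<phi> z) < cmod (\<phi> (A \<zeta>) + cnj (\<phi> z))"
      using power_less_imp_less_base norm_ge_zero by blast
    then show ?thesis using den[OF zb'] by (simp add: q_def norm_divide)
  qed
  have dA: "((\<lambda>\<zeta>. \<phi> (A \<zeta>)) has_field_derivative deriv \<phi> z * of_real d) (at 0)"
  proof -
    have "(A has_field_derivative of_real d) (at 0)"
      unfolding A_def by (auto intro!: derivative_eq_intros)
    moreover have "(\<phi> has_field_derivative deriv \<phi> z) (at (A 0))"
      using holomorphic_derivI[OF holo open_ball zb] by (simp add: A_def)
    ultimately show ?thesis using DERIV_chain2 by blast
  qed
  have s0: "\<phi> z + cnj (\<phi> z) = 2 * of_real (Re (\<phi> z))"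
    by (simp add: complex_eq_iff)
  have "(q has_field_derivative deriv \<phi> z * of_real d / (2 * of_real (Re (\<phi> z)))) (at 0)"
    unfolding q_def
    by (rule derivative_eq_intros dA refl)+ (use u0 in \<open>auto simp: A_def s0\<close>)
  then have "deriv q 0 = deriv \<phi> z * of_real d / (2 * of_real (Re (\<phi> z)))"
    by (rule DERIV_imp_deriv)
  with Schwarz_Lemma(2)[OF hq q0 q1, of 0]
  have "cmod (deriv \<phi> z * of_real d / (2 * of_real (Re (\<phi> z)))) \<le> 1" by simp
  then show "cmod (deriv \<phi> z) \<le> 2 * Re (\<phi> z) / d"
    using u0 d by (simp add: norm_mult norm_divide field_simps)
  assume w: "w \<in> ball z d"
  define \<zeta> where "\<zeta> = (w - z) / of_real d"
  define s where "s = dist z w / d"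
  have Aw: "A \<zeta> = w" using d by (simp add: A_def \<zeta>_def)
  have ns: "cmod \<zeta> = s" using d by (simp add: \<zeta>_def s_def norm_divide dist_norm norm_minus_commute)
  have s1: "s < 1" "s \<ge> 0" using w d by (auto simp: s_def)
  define P where "P = cmod (\<phi> w + cnj (\<phi> z))"
  have "cmod (q \<zeta>) \<le> s" using Schwarz_Lemma(1)[OF hq q0 q1, of \<zeta>] s1 ns by simp
  then have le: "cmod (\<phi> w - \<phi> z) \<le> s * P"
    using den[of \<zeta>] s1 ns by (simp add: q_def Aw P_def norm_divide field_simps)
  \<comment> \<open>The triangle inequality turns |q| \<le> s into a lower bound for P. The identity
    \<open>Re_mul_eq_norm_diff\<close> then yields the Harnack factor (1 - s) / (1 + s).\<close>
  have "2 * Re (\<phi> z) = cmod (\<phi> z + cnj (\<phi> z))" using u0 by (simp only: s0 norm_mult) simp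
  also have "\<dots> \<le> P + cmod (\<phi> w - \<phi> z)"
    unfolding P_def
    using norm_triangle_ineq4[of "\<phi> w + cnj (\<phi> z)" "\<phi> w - \<phi> z"] by (simp add: algebra_simps)
  also have "\<dots> \<le> (1 + s) * P" using le by (simp add: algebra_simps)
  finally have P: "2 * Re (\<phi> z) / (1 + s) \<le> P" using s1 by (simp add: field_simps)
  have "(1 - s\<^sup>2) * (2 * Re (\<phi> z) / (1 + s))\<^sup>2 \<le> (1 - s\<^sup>2) * P\<^sup>2"
    using P s1 u0 by (intro mult_left_mono power_mono) (auto simp: power_le_one)
  also have "\<dots> \<le> P\<^sup>2 - (cmod (\<phi> w - \<phi> z))\<^sup>2"
    using power_mono[OF le norm_ge_zero, of 2] by (simp add: algebra_simps power_mult_distrib)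
  also have "\<dots> = 4 * Re (\<phi> w) * Re (\<phi> z)" unfolding P_def Re_mul_eq_norm_diff ..
  finally have "(1 - s\<^sup>2) * (4 * (Re (\<phi> z))\<^sup>2) / (1 + s)\<^sup>2 \<le> 4 * Re (\<phi> w) * Re (\<phi> z)"
    by (simp add: power_divide power_mult_distrib)
  moreover have "(1 - s\<^sup>2) * (4 * (Re (\<phi> z))\<^sup>2) / (1 + s)\<^sup>2 = 4 * (Re (\<phi> z) * (1 - s) / (1 + s)) * Re (\<phi> z)"
  proof -
    have "1 - s\<^sup>2 = (1 - s) * (1 + s)" by (simp add: power2_eq_square algebra_simps)
    then show ?thesis using s1 by (simp add: power2_eq_square)
  qed
  ultimately have "4 * (Re (\<phi> z) * (1 - s) / (1 + s)) * Re (\<phi> z) \<le> 4 * Re (\<phi> w) * Re (\<phi> z)" by simp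
  then have "Re (\<phi> z) * (1 - s) / (1 + s) \<le> Re (\<phi> w)"
    using u0 mult_le_cancel_right_pos[of "4 * Re (\<phi> z)" "Re (\<phi> z) * (1 - s) / (1 + s)" "Re (\<phi> w)"]
    by (simp only: mult_ac zero_less_mult_iff) simp
  moreover have "Re (\<phi> z) * (1 - s) / (1 + s) = Re (\<phi> z) * (d - dist z w) / (d + dist z w)"
    using d zero_le_dist[of z w] s1 by (simp add: s_def divide_simps del: zero_le_dist)
  ultimately show "Re (\<phi> w) \<ge> Re (\<phi> z) * (d - dist z w) / (d + dist z w)" by simp
qed

text \<open>A quantitative Hopf lemma: with u = ln |f z| and d the radius of the disc, the slope at
  the touching point is at least u / (2 d), so u \<le> 2 K d. The gradient bound 2 u / d at the
  centre is then at most 4 K. The domain A is kept general because rescaled functions are controlled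
  on discs only.\<close>

lemma ln_norm_le_of_level_deriv_bound:
  assumes holo: "f holomorphic_on A" and A: "open A" and sub: "cball z (dist z p) \<subseteq> A"
    and p: "cmod (f p) \<le> 1" and z: "cmod (f z) > 1"
    and K: "\<And>\<zeta>. \<zeta> \<in> A \<Longrightarrow> cmod (f \<zeta>) = 1 \<Longrightarrow> cmod (deriv f \<zeta>) \<le> K"
  shows "ln (cmod (f z)) \<le> 2 * K * dist z p" and "cmod (deriv f z) \<le> 4 * K * cmod (f z)"
proof -
  define D where "D = cball z (dist z p)"
  have cD: "continuous_on D (\<lambda>w. cmod (f w))"
    using holo sub unfolding D_def
    by (intro continuous_on_norm holomorphic_on_imp_continuous_on holomorphic_on_subset[OF holo])
  define S where "S = {w \<in> D. cmod (f w) \<le> 1}"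
  have "closed S" unfolding S_def
    using continuous_closed_preimage[OF cD _ closed_atMost[of 1]]
    by (simp add: D_def vimage_def Int_def)
  moreover have "p \<in> S" using p by (simp add: S_def D_def dist_commute)
  ultimately obtain \<zeta> where \<zeta>: "\<zeta> \<in> S" and near: "\<And>y. y \<in> S \<Longrightarrow> dist z \<zeta> \<le> dist z y"
    using distance_attains_inf[of S z] by blast
  define d where "d = dist z \<zeta>"
  have dp: "d \<le> dist z p" using near[OF \<open>p \<in> S\<close>] by (simp add: d_def)
  have "z \<noteq> \<zeta>" using \<zeta> z by (auto simp: S_def)
  then have d: "d > 0" by (simp add: d_def)
  have bD: "ball z d \<subseteq> D" using dp by (auto simp: D_def)
  have big: "cmod (f w) > 1" if "w \<in> ball z d" for w
  proof (rule ccontr)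
    assume "\<not> cmod (f w) > 1"
    then have "w \<in> S" using that bD by (auto simp: S_def)
    from near[OF this] that show False by (simp add: d_def)
  qed
  have bA: "ball z d \<subseteq> A" using bD sub by (auto simp: D_def)
  have "f w \<noteq> 0" if "w \<in> ball z d" for w using big[OF that] by auto
  then obtain L where L: "L holomorphic_on ball z d" "\<And>w. w \<in> ball z d \<Longrightarrow> f w = exp (L w)"
    using contractible_imp_holomorphic_log[OF holomorphic_on_subset[OF holo bA]]
      convex_imp_contractible[OF convex_ball] by metis
  have ReL: "Re (L w) = ln (cmod (f w))" if "w \<in> ball z d" for w
    using L(2)[OF that] by simp
  have pos: "Re (L w) > 0" if "w \<in> ball z d" for w using big[OF that] ReL[OF that] by (simp add: ln_gt_zero)
  define u where "u = ln (cmod (f z))"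
  have zb: "z \<in> ball z d" using d by simp
  have u: "u > 0" "Re (L z) = u" using pos[OF zb] ReL[OF zb] by (auto simp: u_def)
  define W where "W = (\<lambda>s::real. z + of_real s * (\<zeta> - z))"
  have Wb: "dist z (W s) = s * d" if "0 \<le> s" for s
    using that by (simp add: W_def dist_norm norm_mult d_def norm_minus_commute)
  have Wb': "W s \<in> ball z d" if "0 \<le> s" "s < 1" for s
    using Wb[OF that(1)] that d by simp
  \<comment> \<open>W runs along the radius from z to the touching point \<zeta>. The bound
    \<open>exp x \<ge> 1 + x\<close> passes from log |f| to |f|, and the 1 cancels against |f
    \<zeta>| = 1.\<close>
  have lower: "cmod (f (W s)) \<ge> 1 + u * (1 - s) / (1 + s)" if "0 \<le> s" "s < 1" for s
  proof -
    have "Re (L (W s)) \<ge> u * (d - s * d) / (d + s * d)"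
      using positive_real_part_Schwarz(2)[OF L(1) d pos Wb'[OF that]] that by (simp add: Wb u)
    also have "u * (d - s * d) / (d + s * d) = (d * (u * (1 - s))) / (d * (1 + s))"
      by (simp add: algebra_simps)
    also have "\<dots> = u * (1 - s) / (1 + s)" using d by simp
    finally have "u * (1 - s) / (1 + s) \<le> Re (L (W s))" .
    moreover have "1 + Re (L (W s)) \<le> exp (Re (L (W s)))" by (rule exp_ge_add_one_self)
    moreover have "cmod (f (W s)) = exp (Re (L (W s)))" using L(2)[OF Wb'[OF that]] by simp
    ultimately show ?thesis by linarith
  qed
  have \<zeta>A: "\<zeta> \<in> A" using \<zeta> sub by (auto simp: S_def D_def)
  have df: "(f has_field_derivative deriv f \<zeta>) (at \<zeta>)"
    using holomorphic_derivI[OF holo A \<zeta>A] .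
  have Wlim: "(W \<longlongrightarrow> \<zeta>) (at_left 1)"
  proof -
    have "isCont W 1" unfolding W_def by (intro continuous_intros)
    then have "(W \<longlongrightarrow> W 1) (at 1)" by (simp add: isCont_def)
    then show ?thesis by (simp add: W_def filterlim_at_split)
  qed
  have Wne: "eventually (\<lambda>s. W s \<noteq> \<zeta> \<and> 0 \<le> s \<and> s < 1) (at_left 1)"
  proof -
    have "eventually (\<lambda>s::real. s \<in> {0<..<1}) (at_left 1)"
      by (rule eventually_at_left_real) simp
    then show ?thesis
    proof eventually_elim
      case (elim s)
      then have "W s \<in> ball z d" using Wb' by simp
      then show ?case using elim by (auto simp: d_def)
    qed
  qed
  have f\<zeta>: "cmod (f \<zeta>) = 1"
  proof (rule antisym)
    show "cmod (f \<zeta>) \<le> 1" using \<zeta> by (simp add: S_def)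
    have "isCont f \<zeta>" using df DERIV_isCont by blast
    then have "((\<lambda>s. cmod (f (W s))) \<longlongrightarrow> cmod (f \<zeta>)) (at_left 1)"
      using Wlim by (intro tendsto_norm isCont_tendsto_compose[of \<zeta> f])
    then show "cmod (f \<zeta>) \<ge> 1"
    proof (rule tendsto_lowerbound)
      show "eventually (\<lambda>s. 1 \<le> cmod (f (W s))) (at_left 1)"
        using Wne by eventually_elim (use Wb' big in \<open>force intro: less_imp_le\<close>)
    qed simp
  qed
  have quot: "((\<lambda>s. cmod ((f (W s) - f \<zeta>) / (W s - \<zeta>))) \<longlongrightarrow> cmod (deriv f \<zeta>)) (at_left 1)"
  proof -
    have "((\<lambda>y. (f y - f \<zeta>) / (y - \<zeta>)) \<longlongrightarrow> deriv f \<zeta>) (at \<zeta>)"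
      using df by (simp add: has_field_derivative_iff)
    moreover have "filterlim W (at \<zeta>) (at_left 1)"
      using Wlim Wne by (auto simp: filterlim_at elim: eventually_mono)
    ultimately show ?thesis by (intro tendsto_norm) (rule filterlim_compose)
  qed
  have lim: "((\<lambda>s::real. u / (1 + s) / d) \<longlongrightarrow> u / (1 + 1) / d) (at_left 1)"
    using d by (intro tendsto_intros) auto
  \<comment> \<open>Over the remaining length (1 - s) d the modulus drops by at least u (1 - s) / (1
    + s). The factors 1 - s cancel, and s -> 1 leaves the slope u / (2 d).\<close>
  have ev: "eventually (\<lambda>s. u / (1 + s) / d \<le> cmod ((f (W s) - f \<zeta>) / (W s - \<zeta>))) (at_left 1)"
      using Wne
    proof eventually_elim
      case (elim s)
      have "W s - \<zeta> = of_real (s - 1) * (\<zeta> - z)" by (simp add: W_def algebra_simps)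
      then have n: "cmod (W s - \<zeta>) = (1 - s) * d"
        using elim by (simp only: norm_mult norm_of_real) (simp add: d_def dist_norm norm_minus_commute)
      have "u * (1 - s) / (1 + s) \<le> cmod (f (W s)) - cmod (f \<zeta>)" using lower[of s] elim f\<zeta> by simp
      also have "\<dots> \<le> cmod (f (W s) - f \<zeta>)" by (rule norm_triangle_ineq2)
      finally have "u * (1 - s) / (1 + s) / ((1 - s) * d) \<le> cmod (f (W s) - f \<zeta>) / ((1 - s) * d)"
        using elim d by (intro divide_right_mono) auto
      moreover have "u * (1 - s) / (1 + s) / ((1 - s) * d) = u / (1 + s) / d" using elim d by simp
      ultimately show ?case using n by (simp add: norm_divide)
    qed
  have "u / (1 + 1) / d \<le> cmod (deriv f \<zeta>)"
    by (rule tendsto_le[OF _ quot lim ev]) simp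
  also have "\<dots> \<le> K" using K[OF \<zeta>A f\<zeta>] .
  finally have ud: "u \<le> 2 * K * d" using d by (simp add: field_simps)
  have K0: "K \<ge> 0" using K[OF \<zeta>A f\<zeta>] norm_ge_zero order_trans by blast
  show "ln (cmod (f z)) \<le> 2 * K * dist z p"
    using ud dp K0 mult_left_mono[of d "dist z p" "2 * K"] by (simp add: u_def)
  have "cmod (deriv L z) \<le> 2 * u / d"
    using positive_real_part_Schwarz(1)[OF L(1) d pos] u by simp
  also have "\<dots> \<le> 4 * K" using ud d by (simp add: field_simps)
  finally have dL: "cmod (deriv L z) \<le> 4 * K" .
  have "((\<lambda>w. exp (L w)) has_field_derivative exp (L z) * deriv L z) (at z)"
    using holomorphic_derivI[OF L(1) open_ball zb] by (auto intro!: derivative_eq_intros)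
  then have "(f has_field_derivative exp (L z) * deriv L z) (at z)"
    by (rule has_field_derivative_transform_within_open[where S="ball z d"]) (use L zb in auto)
  then have "deriv f z = f z * deriv L z" using L(2)[OF zb] by (simp add: DERIV_imp_deriv)
  then show "cmod (deriv f z) \<le> 4 * K * cmod (f z)"
    using mult_left_mono[OF dL, of "cmod (f z)"] by (simp add: norm_mult mult.commute)
qed

text \<open>The bound propagates to higher levels: where |f| = r > 1, the preceding lemma gives |f'|
  \<le> 4 K r. Thus f / r has derivative at most 4 K on its own unit level, and the comparison can
  start at w even if |f w| > 1. Hence 8 = 2 * 4.\<close>

lemma entire_growth_of_level_deriv_bound:
  assumes holo: "f holomorphic_on UNIV"
    and K: "\<And>\<zeta>. cmod (f \<zeta>) = 1 \<Longrightarrow> cmod (deriv f \<zeta>) \<le> K" and K0: "K \<ge> 0"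
  shows "cmod (f z) \<le> max 1 (cmod (f w)) * exp (8 * K * dist z w)"
proof (cases "cmod (f z) \<le> max 1 (cmod (f w))")
  case True
  also have "max 1 (cmod (f w)) * 1 \<le> max 1 (cmod (f w)) * exp (8 * K * dist z w)"
    using K0 by (intro mult_left_mono) auto
  finally show ?thesis by simp
next
  case False
  define r where "r = max 1 (cmod (f w))"
  have r: "r \<ge> 1" "cmod (f w) \<le> r" "cmod (f z) > r" using False by (auto simp: r_def)
  \<comment> \<open>If |f| > 1 everywhere, then 1 / f is bounded and f is constant by Liouville,
    against |f w| \<le> r < |f z|.\<close>
  obtain p where p: "cmod (f p) \<le> 1"
  proof (rule ccontr)
    assume "\<not> thesis"
    then have big: "cmod (f p) > 1" for p using that[of p] by (meson not_le)
    have nz: "f p \<noteq> 0" for p using big[of p] by (metis norm_zero not_one_less_zero)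
    have "(\<lambda>z. inverse (f z)) holomorphic_on UNIV"
      using nz by (intro holomorphic_intros holo) auto
    moreover have "bounded (range (\<lambda>z. inverse (f z)))"
      unfolding bounded_iff using big by (intro exI[of _ 1]) (auto simp: norm_inverse inverse_le_1_iff intro: less_imp_le)
    ultimately have "(\<lambda>z. inverse (f z)) constant_on UNIV" by (rule Liouville_theorem)
    then have "f z = f w" unfolding constant_on_def by (metis UNIV_I inverse_inverse_eq)
    then show False using r by simp
  qed
  have K4: "cmod (deriv f \<zeta>) \<le> 4 * K * r" if "cmod (f \<zeta>) = r" for \<zeta>
  proof (cases "r = 1")
    case True
    then show ?thesis using K[of \<zeta>] that K0 by simp
  next
    case False
    then show ?thesis
      using ln_norm_le_of_level_deriv_bound(2)[OF holo open_UNIV _ p, of \<zeta> K] K that r by simp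
  qed
  define h where "h = (\<lambda>x. f x / of_real r)"
  have hh: "h holomorphic_on UNIV" unfolding h_def using r by (intro holomorphic_intros holo) auto
  have dh: "deriv h \<zeta> = deriv f \<zeta> / of_real r" for \<zeta>
    unfolding h_def using holo by (intro deriv_cdivide_right) (simp add: holomorphic_on_def field_differentiable_def)
  have nh: "cmod (h x) = cmod (f x) / r" for x using r by (simp add: h_def norm_divide)
  have hw: "cmod (h w) \<le> 1" and hz: "1 < cmod (h z)" using r by (simp_all add: nh)
  have hK: "cmod (deriv h \<zeta>) \<le> 4 * K" if "cmod (h \<zeta>) = 1" for \<zeta>
    using K4[of \<zeta>] that r K0 by (simp add: nh dh norm_divide divide_le_eq)
  have "ln (cmod (h z)) \<le> 2 * (4 * K) * dist z w"
    by (rule ln_norm_le_of_level_deriv_bound(1)[OF hh open_UNIV _ hw hz]) (use hK in auto)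
  then have "cmod (h z) \<le> exp (8 * K * dist z w)"
    using hz ln_le_cancel_iff[of "cmod (h z)" "exp (8 * K * dist z w)"] by (simp del: zero_less_norm_iff)
  then show ?thesis using r by (simp add: nh r_def[symmetric] field_simps)
qed

text \<open>A logarithm L of g has real part of at most linear growth. The half-plane gradient bound
  on discs of radius d -> \<infinity> (a form of Borel-Caratheodory) bounds L', so L is
  affine.\<close>

lemma nonvanishing_entire_exponential_type:
  assumes holo: "g holomorphic_on UNIV" and nz: "\<And>z. g z \<noteq> 0"
    and bound: "\<And>z. cmod (g z) \<le> A * exp (B * cmod z)" and B: "B \<ge> 0"
  obtains l m where "\<And>z. g z = exp (l * z + m)"
proof -
  obtain L where L: "L holomorphic_on UNIV" "\<And>z. g z = exp (L z)"
    using contractible_imp_holomorphic_log[OF holo contractible_UNIV] nz by auto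
  have "cmod (g 0) > 0" using nz by simp
  then have A: "A > 0" using bound[of 0] by (simp del: zero_less_norm_iff)
  have ReL: "Re (L z) \<le> ln A + B * cmod z" for z
  proof -
    have "exp (Re (L z)) \<le> exp (ln A + B * cmod z)"
      using bound[of z] A L(2)[of z] by (simp add: exp_add)
    then show ?thesis by simp
  qed
  have "cmod (deriv L z) \<le> 2 * B" for z
  proof -
    \<comment> \<open>The upper bound \<open>ln A + B (|z| + d)\<close> for Re L on the disc is
      raised by 1 to make Re \<phi> strictly positive. Then Re (\<phi> z) = C + B d, and after
      division by d only B survives.\<close>
    define C where "C = ln A + B * cmod z + 1 - Re (L z)"
    have "cmod (deriv L z) \<le> 2 * (C + B * d) / d" if d: "d > 0" for d
    proof -
      define \<phi> where "\<phi> = (\<lambda>w. of_real (ln A + B * (cmod z + d) + 1) - L w)"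
      have h: "\<phi> holomorphic_on ball z d"
        unfolding \<phi>_def by (intro holomorphic_intros holomorphic_on_subset[OF L(1)]) auto
      have pos: "Re (\<phi> w) > 0" if "w \<in> ball z d" for w
      proof -
        have "cmod w \<le> cmod z + d"
          using that norm_triangle_ineq[of z "w - z"] by (simp add: dist_norm norm_minus_commute)
        then have "B * cmod w \<le> B * (cmod z + d)" using B by (rule mult_left_mono)
        then show ?thesis using ReL[of w] by (simp add: \<phi>_def)
      qed
      have "cmod (deriv \<phi> z) \<le> 2 * Re (\<phi> z) / d" by (rule positive_real_part_Schwarz(1)[OF h d pos])
      moreover have "deriv \<phi> z = - deriv L z"
        unfolding \<phi>_def using L(1)
        by (subst deriv_diff) (auto simp: holomorphic_on_def field_differentiable_def)
      moreover have "Re (\<phi> z) = C + B * d" by (simp add: \<phi>_def C_def algebra_simps)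
      ultimately show ?thesis by simp
    qed
    then have "eventually (\<lambda>d. cmod (deriv L z) \<le> 2 * (C + B * d) / d) at_top"
      by (rule eventually_mono[OF eventually_gt_at_top[of 0]])
    moreover have "((\<lambda>d. 2 * (C + B * d) / d) \<longlongrightarrow> 2 * B) at_top"
    proof -
      have "((\<lambda>d. 2 * C / d + 2 * B) \<longlongrightarrow> 0 + 2 * B) at_top"
        by (intro tendsto_intros tendsto_divide_0[OF tendsto_const] filterlim_at_top_imp_at_infinity filterlim_ident)
      moreover have "eventually (\<lambda>d::real. 2 * C / d + 2 * B = 2 * (C + B * d) / d) at_top"
        using eventually_gt_at_top[of 0] by eventually_elim (simp add: field_simps)
      ultimately show ?thesis by (simp add: Lim_transform_eventually)
    qed
    ultimately show ?thesis
      by (intro tendsto_lowerbound[of _ "2 * B" at_top]) auto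
  qed
  then have "bounded (range (deriv L))" by (auto simp: bounded_iff)
  then have "deriv L constant_on UNIV"
    by (intro Liouville_theorem holomorphic_deriv[OF L(1)]) auto
  then obtain l where l: "\<And>z. deriv L z = l" by (auto simp: constant_on_def)
  have "((\<lambda>z. L z - l * z) has_field_derivative 0) (at z)" for z
    using holomorphic_derivI[OF L(1) open_UNIV, of z] l by (auto intro!: derivative_eq_intros)
  then obtain m where "\<And>z. L z - l * z = m"
    using has_field_derivative_zero_constant[of UNIV "\<lambda>z. L z - l * z"] by auto
  then have "L z = l * z + m" for z by (metis diff_add_cancel add.commute)
  then show thesis using that L(2) by metis
qed

subsection \<open>Locally uniform limits of entire functions\<close>

text \<open>Holomorphy of all members and of the limit is built in, so that sums, products and
  derivatives obey closure rules without side conditions.\<close>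

definition entire_limit :: "(nat \<Rightarrow> complex \<Rightarrow> complex) \<Rightarrow> (complex \<Rightarrow> complex) \<Rightarrow> bool" where
  "entire_limit F g \<longleftrightarrow> (\<forall>n. F n holomorphic_on UNIV) \<and> g holomorphic_on UNIV \<and>
     (\<forall>R. uniform_limit (cball 0 R) F g sequentially)"

lemma entire_limitD:
  assumes "entire_limit F g"
  shows "F n holomorphic_on UNIV" "g holomorphic_on UNIV" "uniform_limit (cball 0 R) F g sequentially"
  using assms by (auto simp: entire_limit_def)

lemma entire_limit_compact:
  assumes "entire_limit F g" "compact S"
  shows "uniform_limit S F g sequentially"
proof -
  obtain R where "S \<subseteq> cball 0 R"
    using bounded_subset_ballD[OF compact_imp_bounded[OF assms(2)], of 0] ball_subset_cball by blast
  with entire_limitD(3)[OF assms(1)] show ?thesis by (rule uniform_limit_on_subset)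
qed

lemma entire_limit_pointwise: "entire_limit F g \<Longrightarrow> (\<lambda>n. F n z) \<longlonglongrightarrow> g z"
  using entire_limit_compact[of F g "{z}"] by simp

lemma entire_limit_const:
  assumes "c \<longlonglongrightarrow> c'"
  shows "entire_limit (\<lambda>n z. c n) (\<lambda>z. c')"
proof -
  have "uniform_limit S (\<lambda>n z. c n) (\<lambda>z. c') sequentially" for S :: "complex set"
  proof (rule uniform_limitI)
    fix e :: real assume "e > 0"
    then have "eventually (\<lambda>n. dist (c n) c' < e) sequentially" by (rule tendstoD[OF assms])
    then show "eventually (\<lambda>n. \<forall>x\<in>S. dist (c n) c' < e) sequentially" by eventually_elim simp
  qed
  then show ?thesis by (simp add: entire_limit_def)
qed

lemma entire_limit_id: "h holomorphic_on UNIV \<Longrightarrow> entire_limit (\<lambda>n. h) h"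
  by (simp add: entire_limit_def uniform_limit_iff)

lemma bounded_image_cball:
  assumes "g holomorphic_on UNIV"
  shows "bounded (g ` cball (0::complex) R)"
proof (intro compact_imp_bounded compact_continuous_image compact_cball)
  show "continuous_on (cball 0 R) g"
    using assms holomorphic_on_subset holomorphic_on_imp_continuous_on by blast
qed

lemma entire_limit_mult:
  assumes "entire_limit F f" "entire_limit G g"
  shows "entire_limit (\<lambda>n z. F n z * G n z) (\<lambda>z. f z * g z)"
  unfolding entire_limit_def
  by (intro conjI allI holomorphic_on_mult uniform_lim_mult bounded_image_cball
        entire_limitD[OF assms(1)] entire_limitD[OF assms(2)])

lemma entire_limit_diff:
  assumes "entire_limit F f" "entire_limit G g"
  shows "entire_limit (\<lambda>n z. F n z - G n z) (\<lambda>z. f z - g z)"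
  unfolding entire_limit_def
  by (intro conjI allI holomorphic_on_diff uniform_limit_minus
        entire_limitD[OF assms(1)] entire_limitD[OF assms(2)])

lemma entire_limit_power:
  assumes "entire_limit F f"
  shows "entire_limit (\<lambda>n z. F n z ^ m) (\<lambda>z. f z ^ m)"
proof (induction m)
  case 0
  show ?case using entire_limit_const[OF tendsto_const, of 1] by simp
next
  case (Suc m)
  show ?case using entire_limit_mult[OF assms Suc] by simp
qed

lemma entire_limit_prod:
  assumes "finite A" "\<And>j. j \<in> A \<Longrightarrow> entire_limit (F j) (f j)"
  shows "entire_limit (\<lambda>n z. \<Prod>j\<in>A. F j n z) (\<lambda>z. \<Prod>j\<in>A. f j z)"
  using assms
proof (induction A rule: finite_induct)
  case empty
  show ?case using entire_limit_const[OF tendsto_const, of 1] by simp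
next
  case (insert j A)
  then show ?case using entire_limit_mult[of "F j" "f j"] by simp
qed

lemma entire_limit_deriv:
  assumes "entire_limit F g"
  shows "entire_limit (\<lambda>n. deriv (F n)) (deriv g)"
proof -
  note F = entire_limitD[OF assms]
  have "uniform_limit (cball 0 R) (\<lambda>n. deriv (F n)) (deriv g) sequentially" for R
  proof (rule uniform_limitI)
    fix e :: real assume e: "e > 0"
    \<comment> \<open>The radius R + 1 makes room for the unit circles in Cauchy's
      inequality.\<close>
    have "eventually (\<lambda>n. \<forall>x\<in>cball 0 (R + 1). dist (F n x) (g x) < e / 2) sequentially"
      using uniform_limitD[OF F(3), of "e / 2" "R + 1"] e by simp
    then show "eventually (\<lambda>n. \<forall>x\<in>cball 0 R. dist (deriv (F n) x) (deriv g x) < e) sequentially"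
    proof (eventually_elim, intro ballI)
      fix n x assume n: "\<forall>x\<in>cball 0 (R + 1). dist (F n x) (g x) < e / 2" and x: "x \<in> cball (0::complex) R"
      have h: "(\<lambda>w. F n w - g w) holomorphic_on UNIV" by (intro holomorphic_intros F)
      have "cmod ((deriv ^^ 1) (\<lambda>w. F n w - g w) x) \<le> fact 1 * (e / 2) / 1 ^ 1"
      proof (rule Cauchy_inequality)
        fix y assume "cmod (x - y) = 1"
        then have "y \<in> cball 0 (R + 1)"
          using x norm_triangle_ineq[of x "y - x"] by (simp add: norm_minus_commute)
        then show "cmod (F n y - g y) \<le> e / 2" using n by (force simp: dist_norm)
      next
        show "(\<lambda>w. F n w - g w) holomorphic_on ball x 1" using h holomorphic_on_subset by blast
        show "continuous_on (cball x 1) (\<lambda>w. F n w - g w)"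
          using h holomorphic_on_subset holomorphic_on_imp_continuous_on by blast
      qed simp
      moreover have "deriv (\<lambda>w. F n w - g w) x = deriv (F n) x - deriv g x"
        using F by (intro deriv_diff) (auto simp: holomorphic_on_def field_differentiable_def)
      ultimately show "dist (deriv (F n) x) (deriv g x) < e" using e by (simp add: dist_norm)
    qed
  qed
  moreover have "deriv (F n) holomorphic_on UNIV" "deriv g holomorphic_on UNIV" for n
    using F holomorphic_deriv open_UNIV by blast+
  ultimately show ?thesis by (simp add: entire_limit_def)
qed

lemma entire_limit_higher_deriv:
  assumes "entire_limit F g"
  shows "entire_limit (\<lambda>n. (deriv ^^ m) (F n)) ((deriv ^^ m) g)"
proof (induction m)
  case 0
  show ?case using assms by simp
next
  case (Suc m)
  show ?case using entire_limit_deriv[OF Suc] by simp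
qed

lemma entire_limit_subseq:
  assumes "entire_limit F g" "strict_mono r"
  shows "entire_limit (\<lambda>n. F (r n)) g"
  unfolding entire_limit_def
  by (intro conjI allI entire_limitD[OF assms(1)]
        filterlim_compose[OF entire_limitD(3)[OF assms(1)] filterlim_subseq[OF assms(2)]])

text \<open>The bound is demanded only from some index on, depending on R, because rescaled
  functions are controlled on discs that grow with the index. The finitely many earlier functions
  are bounded by continuity.\<close>

lemma Montel_entire:
  assumes holo: "\<And>n. F n holomorphic_on UNIV"
    and bdd: "\<And>R. \<exists>B. eventually (\<lambda>n. \<forall>z\<in>cball 0 R. cmod (F n z) \<le> B) sequentially"
  obtains g r where "strict_mono (r :: nat \<Rightarrow> nat)" "entire_limit (\<lambda>n. F (r n)) g"
proof -
  have "\<exists>B. \<forall>h\<in>range F. \<forall>z\<in>S. cmod (h z) \<le> B" if S: "compact S" for S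
  proof -
    obtain R where R: "S \<subseteq> cball 0 R"
      using bounded_subset_ballD[OF compact_imp_bounded[OF S], of 0] ball_subset_cball by blast
    obtain B n0 where B: "\<And>n z. n \<ge> n0 \<Longrightarrow> z \<in> cball 0 R \<Longrightarrow> cmod (F n z) \<le> B"
      using bdd[of R] unfolding eventually_sequentially by blast
    have "\<exists>C. \<forall>z\<in>cball 0 R. cmod (F n z) \<le> C" for n
      using bounded_image_cball[OF holo, of n R] by (auto simp: bounded_iff)
    then obtain C where C: "\<And>n z. z \<in> cball 0 R \<Longrightarrow> cmod (F n z) \<le> C n" by metis
    have "cmod (F n z) \<le> max B (Max (C ` {..n0}))" if "z \<in> S" for n z
    proof (cases "n \<ge> n0")
      case True
      then show ?thesis using B[of n z] that R by auto
    next
      case False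
      then have "C n \<le> Max (C ` {..n0})" by (intro Max_ge) auto
      then show ?thesis using C[of z n] that R by fastforce
    qed
    then show ?thesis by blast
  qed
  then have bd: "\<And>S. compact S \<Longrightarrow> S \<subseteq> UNIV \<Longrightarrow> \<exists>B. \<forall>h\<in>range F. \<forall>z\<in>S. cmod (h z) \<le> B"
    by blast
  have hol: "h holomorphic_on UNIV" if "h \<in> range F" for h using that holo by auto
  obtain g r where "g holomorphic_on UNIV" "strict_mono r"
    "\<And>K. compact K \<Longrightarrow> K \<subseteq> UNIV \<Longrightarrow> uniform_limit K (F \<circ> r) g sequentially"
    using Montel[OF open_UNIV hol bd order_refl] by metis
  then show thesis using that[of r g] holo by (simp add: entire_limit_def o_def)
qed

lemma constant_on_UNIV_of_constant_on_ball:
  assumes "f holomorphic_on UNIV" "f constant_on ball z r" "r > 0"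
  shows "f constant_on UNIV"
proof -
  obtain c where c: "\<And>w. w \<in> ball z r \<Longrightarrow> f w = c" using assms(2) by (auto simp: constant_on_def)
  have "f w = c" for w
    using analytic_continuation_open[of "ball z r" UNIV f "\<lambda>_. c" w] assms c by auto
  then show ?thesis by (auto simp: constant_on_def)
qed

text \<open>If the limit of \<open>G\<close> does not vanish at \<open>z\<close>, then neither do the \<open>F n\<close> near \<open>z\<close>, and
  Hurwitz' theorem applies to them.\<close>
lemma entire_limit_shared_zeros:
  assumes F: "entire_limit F f" and G: "entire_limit G g"
    and shared: "\<And>n z. F n z = 0 \<Longrightarrow> G n z = 0"
    and nonconst: "\<not> f constant_on UNIV" and z: "f z = 0"
  shows "g z = 0"
proof (rule ccontr)
  assume gz: "g z \<noteq> 0"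
  have "isCont g z" using entire_limitD(2)[OF G]
    by (meson UNIV_I continuous_on_eq_continuous_at holomorphic_on_imp_continuous_on open_UNIV)
  then obtain d where d: "d > 0" "\<And>w. dist w z < d \<Longrightarrow> dist (g w) (g z) < cmod (g z) / 2"
    unfolding continuous_at_eps_delta using gz by (metis half_gt_zero zero_less_norm_iff)
  have low: "cmod (g w) > cmod (g z) / 2" if "w \<in> ball z d" for w
    using d(2)[of w] that norm_triangle_ineq2[of "g z" "g w"] by (simp add: dist_norm norm_minus_commute)
  have "uniform_limit (cball z (d/2)) G g sequentially"
    by (intro entire_limit_compact[OF G] compact_cball)
  then have "eventually (\<lambda>n. \<forall>w\<in>cball z (d/2). dist (G n w) (g w) < cmod (g z) / 2) sequentially"
    using gz by (intro uniform_limitD) auto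
  then obtain n0 where n0: "\<And>n w. n \<ge> n0 \<Longrightarrow> w \<in> cball z (d/2) \<Longrightarrow> dist (G n w) (g w) < cmod (g z) / 2"
    unfolding eventually_sequentially by blast
  have nz: "F (n + n0) w \<noteq> 0" if "w \<in> ball z (d/2)" for n w
  proof
    assume "F (n + n0) w = 0"
    then have "G (n + n0) w = 0" by (rule shared)
    moreover have "dist (G (n + n0) w) (g w) < cmod (g z) / 2" using n0 that by simp
    moreover have "w \<in> ball z d" using that d(1) by simp
    ultimately show False using low[of w] by simp
  qed
  have "f z \<noteq> 0"
  proof (rule Hurwitz_no_zeros[of "ball z (d/2)" "\<lambda>n. F (n + n0)" f])
    show "F (n + n0) holomorphic_on ball z (d/2)" for n
      using entire_limitD(1)[OF F] holomorphic_on_subset by blast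
    show "f holomorphic_on ball z (d/2)"
      using entire_limitD(2)[OF F] holomorphic_on_subset by blast
    show "uniform_limit K (\<lambda>n. F (n + n0)) f sequentially" if "compact K" "K \<subseteq> ball z (d/2)" for K
      using entire_limit_compact[OF entire_limit_subseq[OF F, of "\<lambda>n. n + n0"] that(1)]
      by (simp add: strict_mono_def)
    show "\<not> f constant_on ball z (d/2)"
      using constant_on_UNIV_of_constant_on_ball[OF entire_limitD(2)[OF F]] nonconst d(1) by force
  qed (use nz d(1) in auto)
  then show False using z by simp
qed

text \<open>The limit q may vanish at 0, but its zeros are isolated. On a small circle around 0 that
  avoids them, \<open>R n\<close> stays away from 0, so \<open>Q n\<close> is bounded there; being
  entire, it is then bounded at the centre together with its derivative.\<close>

lemma entire_limit_quotient_bounded: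
  assumes P: "entire_limit P p" and R: "entire_limit R q" and Q: "\<And>n. Q n holomorphic_on UNIV"
    and eq: "\<And>n z. Q n z * R n z = P n z" and nz: "q w \<noteq> 0"
  shows "\<exists>B. eventually (\<lambda>n. cmod (Q n 0) \<le> B \<and> cmod (deriv (Q n) 0) \<le> B) sequentially"
proof -
  note q = entire_limitD(2)[OF R]
  have cont: "continuous_on S p" "continuous_on S q" for S
    using entire_limitD(2)[OF P] q holomorphic_on_imp_continuous_on continuous_on_subset by blast+
  obtain d where d: "d > 0" "\<And>z. z \<in> ball 0 d - {0} \<Longrightarrow> q z \<noteq> 0"
  proof (cases "q 0 = 0")
    case True
    then show ?thesis
      using isolated_zeros[OF q open_UNIV connected_UNIV UNIV_I True UNIV_I nz] that by metis
  next
    case False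
    have "isCont q 0" using cont(2)[of UNIV] by (simp add: continuous_on_eq_continuous_at)
    then obtain d where d: "d > 0" "\<And>z. dist z 0 < d \<Longrightarrow> q z \<noteq> 0"
      using continuous_at_avoid[of 0 q 0] False by (metis dist_commute)
    then show ?thesis using that[of d] by (simp add: dist_commute)
  qed
  define \<rho> where "\<rho> = d / 2"
  have \<rho>: "\<rho> > 0" using d by (simp add: \<rho>_def)
  have qs: "q z \<noteq> 0" if "z \<in> sphere 0 \<rho>" for z
    using d that by (auto simp: \<rho>_def)
  have "sphere (0::complex) \<rho> \<noteq> {}" using \<rho> by simp
  then obtain z0 where z0: "z0 \<in> sphere 0 \<rho>" "\<And>z. z \<in> sphere 0 \<rho> \<Longrightarrow> cmod (q z0) \<le> cmod (q z)"
    using continuous_attains_inf[OF compact_sphere _ continuous_on_norm[OF cont(2)]] by metis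
  define m where "m = cmod (q z0)"
  have m: "m > 0" using qs[OF z0(1)] by (simp add: m_def)
  obtain C where C: "\<And>z. z \<in> cball 0 \<rho> \<Longrightarrow> cmod (p z) \<le> C"
    using bounded_image_cball[OF entire_limitD(2)[OF P], of \<rho>] unfolding bounded_iff by (metis imageI)
  have "eventually (\<lambda>n. \<forall>z\<in>cball 0 \<rho>. dist (P n z) (p z) < 1) sequentially"
    using uniform_limitD[OF entire_limitD(3)[OF P]] by simp
  moreover have "eventually (\<lambda>n. \<forall>z\<in>cball 0 \<rho>. dist (R n z) (q z) < m / 2) sequentially"
    using uniform_limitD[OF entire_limitD(3)[OF R], of "m / 2" \<rho>] m by simp
  ultimately have "eventually (\<lambda>n. \<forall>z\<in>sphere 0 \<rho>. cmod (Q n z) \<le> (C + 1) / (m / 2)) sequentially"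
  proof (eventually_elim, intro ballI)
    fix n z
    assume a: "\<forall>z\<in>cball 0 \<rho>. dist (P n z) (p z) < 1" "\<forall>z\<in>cball 0 \<rho>. dist (R n z) (q z) < m / 2"
      and z: "z \<in> sphere (0::complex) \<rho>"
    have zc: "z \<in> cball 0 \<rho>" using z by simp
    have P: "cmod (P n z) \<le> C + 1"
      using bspec[OF a(1) zc] C[OF zc] norm_triangle_ineq2[of "P n z" "p z"] by (simp add: dist_norm)
    moreover have R: "cmod (R n z) \<ge> m / 2"
      using bspec[OF a(2) zc] z0(2)[OF z] norm_triangle_ineq2[of "q z" "R n z"]
      by (simp add: dist_norm norm_minus_commute m_def)
    moreover have "cmod (Q n z) = cmod (P n z) / cmod (R n z)"
      using R m eq[of n z, symmetric] by (auto simp: norm_mult)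
    ultimately have "cmod (Q n z) = cmod (P n z) / cmod (R n z)" by simp
    also have "\<dots> \<le> (C + 1) / (m / 2)"
      using P R m order_trans[OF norm_ge_zero P] by (intro frac_le) auto
    finally show "cmod (Q n z) \<le> (C + 1) / (m / 2)" .
  qed
  then have "eventually (\<lambda>n. cmod (Q n 0) \<le> (C + 1) / (m / 2) \<and> cmod (deriv (Q n) 0) \<le> (C + 1) / (m / 2) / \<rho>) sequentially"
  proof eventually_elim
    case (elim n)
    have "cmod ((deriv ^^ i) (Q n) 0) \<le> fact i * ((C + 1) / (m / 2)) / \<rho> ^ i" for i
    proof (rule Cauchy_inequality)
      show "Q n holomorphic_on ball 0 \<rho>" using Q holomorphic_on_subset by blast
      show "continuous_on (cball 0 \<rho>) (Q n)"
        using Q holomorphic_on_subset holomorphic_on_imp_continuous_on by blast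
    qed (use elim \<rho> in auto)
    from this[of 0] this[of 1] show ?case by simp
  qed
  then have "eventually (\<lambda>n. cmod (Q n 0) \<le> max ((C + 1) / (m / 2)) ((C + 1) / (m / 2) / \<rho>) \<and>
      cmod (deriv (Q n) 0) \<le> max ((C + 1) / (m / 2)) ((C + 1) / (m / 2) / \<rho>)) sequentially"
    by eventually_elim auto
  then show ?thesis by blast
qed

subsection \<open>Differential monomials\<close>

text \<open>Each differentiation lowers the exponent of f by one and changes the cofactor. At a
  simple zero of f the new cofactor is (m + 1) f' H, a nonzero multiple of the old one. The
  induction carries this along to give exact vanishing orders later.\<close>

lemma higher_deriv_factor:
  fixes f u :: "complex \<Rightarrow> complex"
  assumes S: "open S" and f: "f holomorphic_on S" and u: "u holomorphic_on S"
    and \<phi>: "\<And>w. w \<in> S \<Longrightarrow> \<phi> w = f w ^ q * u w" and "t \<le> q"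
  shows "\<exists>H. H holomorphic_on S \<and> (\<forall>w\<in>S. (deriv ^^ t) \<phi> w = f w ^ (q - t) * H w) \<and>
           (\<forall>z\<in>S. f z = 0 \<and> deriv f z \<noteq> 0 \<and> u z \<noteq> 0 \<longrightarrow> H z \<noteq> 0)"
  using \<open>t \<le> q\<close>
proof (induction t)
  case 0
  then show ?case using u \<phi> by auto
next
  case (Suc t)
  then obtain H where H: "H holomorphic_on S" "\<And>w. w \<in> S \<Longrightarrow> (deriv ^^ t) \<phi> w = f w ^ (q - t) * H w"
    "\<And>z. z \<in> S \<Longrightarrow> f z = 0 \<Longrightarrow> deriv f z \<noteq> 0 \<Longrightarrow> u z \<noteq> 0 \<Longrightarrow> H z \<noteq> 0" by auto
  define m where "m = q - Suc t"
  have m: "q - t = Suc m" using Suc.prems by (simp add: m_def)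
  define G where "G = (\<lambda>w. of_nat (Suc m) * deriv f w * H w + f w * deriv H w)"
  have "G holomorphic_on S"
    unfolding G_def by (intro holomorphic_intros holomorphic_deriv f H(1) S)
  moreover have "(deriv ^^ Suc t) \<phi> w = f w ^ m * G w" if w: "w \<in> S" for w
  proof -
    have "((\<lambda>w. f w ^ Suc m * H w) has_field_derivative
        of_nat (Suc m) * (deriv f w * f w ^ m) * H w + deriv H w * f w ^ Suc m) (at w)"
      using DERIV_mult[OF DERIV_power_Suc[OF holomorphic_derivI[OF f S w], of m] holomorphic_derivI[OF H(1) S w]]
      by (simp add: mult_ac)
    then have "((deriv ^^ t) \<phi> has_field_derivative
        of_nat (Suc m) * (deriv f w * f w ^ m) * H w + deriv H w * f w ^ Suc m) (at w)"
      by (rule has_field_derivative_transform_within_open[OF _ S w]) (simp add: H(2) m)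
    then show ?thesis by (simp add: DERIV_imp_deriv G_def algebra_simps)
  qed
  moreover have "G z \<noteq> 0" if "z \<in> S" "f z = 0" "deriv f z \<noteq> 0" "u z \<noteq> 0" for z
    using H(3)[OF that] that by (simp add: G_def del: of_nat_Suc)
  ultimately show ?case unfolding m_def by blast
qed

lemma higher_deriv_exp_linear:
  "(deriv ^^ t) (\<lambda>w. c * exp (l * w)) z = l ^ t * (c * exp (l * z))" for c l z :: complex
proof (induction t arbitrary: z)
  case (Suc t)
  have "((\<lambda>w. l ^ t * (c * exp (l * w))) has_field_derivative l ^ Suc t * (c * exp (l * z))) (at z)"
    by (auto intro!: derivative_eq_intros)
  moreover have "(deriv ^^ t) (\<lambda>w. c * exp (l * w)) = (\<lambda>w. l ^ t * (c * exp (l * w)))"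
    using Suc by auto
  ultimately show ?case by (simp add: DERIV_imp_deriv)
qed simp

lemma higher_deriv_compose_affine:
  fixes F :: "complex \<Rightarrow> complex"
  assumes "F holomorphic_on UNIV"
  shows "(deriv ^^ t) (\<lambda>\<zeta>. c * F (\<rho> * \<zeta> + w)) \<zeta> = c * (\<rho> ^ t * (deriv ^^ t) F (\<rho> * \<zeta> + w))"
proof -
  have "(\<lambda>\<zeta>. F (\<rho> * \<zeta> + w)) holomorphic_on UNIV"
    using holomorphic_on_compose_gen[OF _ assms, of "\<lambda>\<zeta>. \<rho> * \<zeta> + w" UNIV]
    by (simp add: o_def holomorphic_intros)
  then have "(deriv ^^ t) (\<lambda>\<zeta>. c * F (\<rho> * \<zeta> + w)) \<zeta> = c * (deriv ^^ t) (\<lambda>\<zeta>. F (\<rho> * \<zeta> + w)) \<zeta>"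
    by (intro higher_deriv_cmult) auto
  then show ?thesis
    using higher_deriv_compose_linear'[OF assms open_UNIV open_UNIV, of \<zeta> \<rho> w t] by simp
qed

lemma holomorphic_eq_0_of_punctured_ball:
  assumes "h holomorphic_on ball z r" "r > 0" "\<And>w. w \<in> ball z r - {z} \<Longrightarrow> h w = 0"
  shows "h z = (0::complex)"
proof -
  have "isCont h z"
    using holomorphic_on_imp_continuous_on[OF assms(1)] assms(2)
    by (simp add: continuous_on_eq_continuous_at)
  then have lim: "(h \<longlongrightarrow> h z) (at z)" by (rule isContD)
  have "eventually (\<lambda>w. h w = 0) (at z)"
    by (rule eventually_mono[OF eventually_at_in_open[OF open_ball, of z z r]]) (use assms(2,3) in auto)
  then have "((\<lambda>_. 0) \<longlongrightarrow> h z) (at z)" by (rule Lim_transform_eventually[OF lim])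
  then show ?thesis by (simp add: tendsto_const_iff)
qed

text \<open>\<open>ts_le_ns\<close> leaves a factor \<open>f ^ (ns j - ts j)\<close> in each
  derivative, and \<open>weight_less_degree\<close> makes the total exponent N - T positive, so that
  M f is divisible by f.\<close>

locale monomial_exponents =
  fixes n k :: nat and ns ts :: "nat \<Rightarrow> nat"
  assumes k_pos: "k \<ge> 1"
    and ts_pos: "j \<in> {1..k} \<Longrightarrow> ts j \<ge> 1"
    and ts_le_ns: "j \<in> {1..k} \<Longrightarrow> ts j \<le> ns j"
    and weight_less_degree: "(\<Sum>j=1..k. ts j) < n + (\<Sum>j=1..k. ns j)"
begin

abbreviation "N \<equiv> n + (\<Sum>j=1..k. ns j)"
abbreviation "T \<equiv> (\<Sum>j=1..k. ts j)"
abbreviation "M \<equiv> diff_monomial n k ns ts"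

text \<open>The factor by which M multiplies the N-th power of an exponential of rate l; see
  \<open>M_exp\<close>.\<close>

definition exp_coeff :: "complex \<Rightarrow> complex" where
  "exp_coeff l = (\<Prod>j=1..k. (l * of_nat (ns j)) ^ ts j)"

lemma M_eq: "M f = (\<lambda>z. f z ^ n * (\<Prod>j=1..k. (deriv ^^ ts j) (\<lambda>w. f w ^ ns j) z))"
  by (rule ext) (simp add: diff_monomial_def)

lemma T_pos: "T > 0"
  using member_le_sum[of 1 "{1..k}" ts] ts_pos[of 1] k_pos by force

lemma N_pos: "N > 0"
  using weight_less_degree by linarith

lemma of_nat_N_nz: "(of_nat N :: complex) \<noteq> 0"
  using N_pos by (subst of_nat_eq_0_iff) (rule less_imp_neq[THEN not_sym])

lemma degree_minus_weight: "n + (\<Sum>j=1..k. ns j - ts j) = N - T"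
  using sum_subtractf_nat[of "{1..k}" ts ns] ts_le_ns sum_mono[of "{1..k}" ts ns] by simp

lemma exp_coeff_eq_0_iff: "exp_coeff l = 0 \<longleftrightarrow> l = 0"
proof
  assume "exp_coeff l = 0"
  then obtain j where j: "j \<in> {1..k}" "(l * of_nat (ns j)) ^ ts j = 0" by (auto simp: exp_coeff_def)
  then have "ns j \<noteq> 0" using ts_pos[OF j(1)] ts_le_ns[OF j(1)] by simp
  then show "l = 0" using j(2) by auto
next
  assume "l = 0"
  then have "(l * of_nat (ns 1)) ^ ts 1 = 0" using ts_pos[of 1] k_pos by simp
  moreover have "1 \<in> {1..k}" using k_pos by simp
  ultimately show "exp_coeff l = 0" unfolding exp_coeff_def by (intro prod_zero) blast+
qed

lemma M_holomorphic: "f holomorphic_on UNIV \<Longrightarrow> M f holomorphic_on UNIV"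
  unfolding M_eq
  by (intro holomorphic_on_mult holomorphic_on_power holomorphic_on_prod holomorphic_higher_deriv) auto

lemma M_exp: "M (\<lambda>z. c * exp (l * z)) z = exp_coeff l * (c * exp (l * z)) ^ N"
proof -
  have "(deriv ^^ t) (\<lambda>w. (c * exp (l * w)) ^ m) z = (l * of_nat m) ^ t * (c * exp (l * z)) ^ m" for t m
  proof -
    have "(c * exp (l * w)) ^ m = c ^ m * exp ((l * of_nat m) * w)" for w
      by (simp add: power_mult_distrib exp_of_nat_mult[symmetric] mult_ac)
    then show ?thesis using higher_deriv_exp_linear[of t "c ^ m" "l * of_nat m" z] by simp
  qed
  then show ?thesis
    by (simp add: diff_monomial_def exp_coeff_def prod.distrib power_add power_sum)
qed

lemma M_const: "M (\<lambda>z. c) z = 0"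
  using M_exp[of c 0 z] exp_coeff_eq_0_iff[of 0] by simp

text \<open>M has degree N in the function and contains T derivatives. The case \<kappa> = 1 serves
  Zalcman's rescaling, the case \<rho> = 1 the normalised translates.\<close>

lemma M_compose_affine:
  assumes f: "f holomorphic_on UNIV"
  shows "M (\<lambda>\<zeta>. f (\<rho> * \<zeta> + w) / \<kappa>) \<zeta> = \<rho> ^ T / \<kappa> ^ N * M f (\<rho> * \<zeta> + w)"
proof -
  have "(deriv ^^ t) (\<lambda>\<zeta>. (f (\<rho> * \<zeta> + w) / \<kappa>) ^ m) \<zeta> =
      1 / \<kappa> ^ m * (\<rho> ^ t * (deriv ^^ t) (\<lambda>w. f w ^ m) (\<rho> * \<zeta> + w))" for t m
    using higher_deriv_compose_affine[of "\<lambda>w. f w ^ m" t "1 / \<kappa> ^ m" \<rho> w \<zeta>] f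
    by (simp add: power_divide holomorphic_on_power)
  then show ?thesis
    by (simp add: diff_monomial_def prod.distrib power_add power_sum power_divide prod_dividef)
qed

lemma M_entire_limit:
  assumes "entire_limit G g"
  shows "entire_limit (\<lambda>i. M (G i)) (M g)"
  unfolding M_eq
  by (intro entire_limit_mult entire_limit_power entire_limit_prod entire_limit_higher_deriv assms) simp

lemma M_factor:
  assumes f: "f holomorphic_on UNIV"
  obtains M1 where "M1 holomorphic_on UNIV" "\<And>z. M f z = f z * M1 z"
proof -
  have "\<exists>H. H holomorphic_on UNIV \<and> (\<forall>w. (deriv ^^ ts j) (\<lambda>w. f w ^ ns j) w = f w ^ (ns j - ts j) * H w)"
    if "j \<in> {1..k}" for j
    using higher_deriv_factor[OF open_UNIV f holomorphic_on_const, of "\<lambda>w. f w ^ ns j" "ns j" 1 "ts j"]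
      ts_le_ns[OF that] by auto
  then obtain H where H: "\<And>j. j \<in> {1..k} \<Longrightarrow> H j holomorphic_on UNIV"
    "\<And>j w. j \<in> {1..k} \<Longrightarrow> (deriv ^^ ts j) (\<lambda>w. f w ^ ns j) w = f w ^ (ns j - ts j) * H j w"
    by metis
  have "M f z = f z ^ (N - T) * (\<Prod>j=1..k. H j z)" for z
  proof -
    have "(\<Prod>j=1..k. (deriv ^^ ts j) (\<lambda>w. f w ^ ns j) z) = (\<Prod>j=1..k. f z ^ (ns j - ts j) * H j z)"
      by (intro prod.cong refl H(2))
    then show ?thesis unfolding diff_monomial_def degree_minus_weight[symmetric]
      by (simp add: prod.distrib power_add power_sum)
  qed
  moreover obtain e where "N - T = Suc e" using weight_less_degree by (metis zero_less_diff gr0_conv_Suc)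
  ultimately have "M f z = f z * (f z ^ e * (\<Prod>j=1..k. H j z))" for z
    by (simp add: mult_ac)
  moreover have "(\<lambda>z. f z ^ e * (\<Prod>j=1..k. H j z)) holomorphic_on UNIV"
    by (intro holomorphic_intros f H(1))
  ultimately show thesis using that by blast
qed

lemma M_zero: "f holomorphic_on UNIV \<Longrightarrow> f z = 0 \<Longrightarrow> M f z = 0"
  using M_factor mult_zero_left by metis

text \<open>With f = (w - z)^p u, \<open>higher_deriv_factor\<close> is applied to the base w - z
  instead of f. Its zero is simple, so no cofactor vanishes at z and the order p N - T is
  exact.\<close>

lemma M_order_at_zero:
  assumes f: "f holomorphic_on UNIV" and nonconst: "\<not> f constant_on UNIV" and z: "f z = 0"
  obtains p r u V where "p > 0" "r > 0" "u holomorphic_on ball z r" "V holomorphic_on ball z r"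
    "u z \<noteq> 0" "V z \<noteq> 0" "\<And>w. w \<in> ball z r \<Longrightarrow> f w = (w - z) ^ p * u w"
    "\<And>w. w \<in> ball z r \<Longrightarrow> M f w = (w - z) ^ (p * N - T) * V w"
proof -
  obtain u r p where p: "0 < p" "0 < r" "u holomorphic_on ball z r"
    "\<And>w. w \<in> ball z r \<Longrightarrow> f w = (w - z) ^ p * u w" "\<And>w. w \<in> ball z r \<Longrightarrow> u w \<noteq> 0"
    using holomorphic_factor_zero_nonconstant[OF f open_UNIV connected_UNIV UNIV_I z nonconst] by metis
  have le: "ts j \<le> p * ns j" if "j \<in> {1..k}" for j
    using ts_le_ns[OF that] p(1) by (metis One_nat_def Suc_leI le_trans mult.commute mult_le_mono2 nat_mult_1_right)
  have zb: "z \<in> ball z r" using p by simp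
  have "\<exists>H. H holomorphic_on ball z r \<and>
      (\<forall>w\<in>ball z r. (deriv ^^ ts j) (\<lambda>w. f w ^ ns j) w = (w - z) ^ (p * ns j - ts j) * H w) \<and> H z \<noteq> 0"
    if "j \<in> {1..k}" for j
  proof -
    have 1: "(\<lambda>w. w - z) holomorphic_on ball z r" by (intro holomorphic_intros)
    have 2: "(\<lambda>w. u w ^ ns j) holomorphic_on ball z r" by (intro holomorphic_intros p)
    have 3: "f w ^ ns j = (w - z) ^ (p * ns j) * u w ^ ns j" if "w \<in> ball z r" for w
      using p(4)[OF that] by (simp add: power_mult_distrib power_mult)
    have "deriv (\<lambda>w. w - z) z = 1" by (rule DERIV_imp_deriv) (auto intro!: derivative_eq_intros)
    then show ?thesis
      using higher_deriv_factor[OF open_ball 1 2 3 le[OF that]] zb p(5)[OF zb] by auto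
  qed
  then obtain H where H: "\<And>j. j \<in> {1..k} \<Longrightarrow> H j holomorphic_on ball z r"
    "\<And>j w. j \<in> {1..k} \<Longrightarrow> w \<in> ball z r \<Longrightarrow>
       (deriv ^^ ts j) (\<lambda>w. f w ^ ns j) w = (w - z) ^ (p * ns j - ts j) * H j w"
    "\<And>j. j \<in> {1..k} \<Longrightarrow> H j z \<noteq> 0" by metis
  define V where "V = (\<lambda>w. u w ^ n * (\<Prod>j=1..k. H j w))"
  have "(\<Sum>j=1..k. p * ns j - ts j) = (\<Sum>j=1..k. p * ns j) - T"
    using le by (intro sum_subtractf_nat) auto
  moreover have "T \<le> (\<Sum>j=1..k. p * ns j)" using le by (intro sum_mono) auto
  ultimately have ex: "p * n + (\<Sum>j=1..k. p * ns j - ts j) = p * N - T"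
    by (simp add: distrib_left sum_distrib_left)
  show thesis
  proof (rule that[of p r u V])
    show "V holomorphic_on ball z r" unfolding V_def by (intro holomorphic_intros p H(1))
    show "V z \<noteq> 0" using H(3) p(5)[OF zb] by (auto simp: V_def)
    show "M f w = (w - z) ^ (p * N - T) * V w" if w: "w \<in> ball z r" for w
    proof -
      have "(\<Prod>j=1..k. (deriv ^^ ts j) (\<lambda>w. f w ^ ns j) w) = (\<Prod>j=1..k. (w - z) ^ (p * ns j - ts j) * H j w)"
        by (intro prod.cong refl H(2) w)
      then show ?thesis unfolding diff_monomial_def V_def ex[symmetric] p(4)[OF w]
        by (simp add: prod.distrib power_add power_sum power_mult_distrib power_mult)
    qed
  qed (use p zb in auto)
qed

text \<open>M f vanishes at z, so constancy would mean M f = 0, which the finite order at z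
  excludes.\<close>

lemma M_not_constant:
  assumes f: "f holomorphic_on UNIV" and nonconst: "\<not> f constant_on UNIV" and z: "f z = 0"
  shows "\<not> M f constant_on UNIV"
proof
  assume "M f constant_on UNIV"
  then have M0: "M f w = 0" for w using M_zero[OF f z] by (metis UNIV_I constant_on_def)
  obtain p r u V where V: "r > 0" "V holomorphic_on ball z r" "V z \<noteq> 0"
    "\<And>w. w \<in> ball z r \<Longrightarrow> M f w = (w - z) ^ (p * N - T) * V w"
    using M_order_at_zero[OF assms] by metis
  have "V w = 0" if "w \<in> ball z r - {z}" for w using V(4)[of w] M0[of w] that by simp
  then show False using holomorphic_eq_0_of_punctured_ball[OF V(2,1)] V(3) by blast
qed

text \<open>The two sides vanish at z to the orders p N - T and p N, and T > 0.\<close>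

lemma M_neq_power:
  assumes f: "f holomorphic_on UNIV" and nonconst: "\<not> f constant_on UNIV" and z: "f z = 0"
  shows "\<exists>w. M f w \<noteq> f w ^ N"
proof (rule ccontr)
  assume "\<not> ?thesis"
  then have eq: "M f w = f w ^ N" for w by blast
  obtain p r u V where V: "p > 0" "r > 0" "u holomorphic_on ball z r" "V holomorphic_on ball z r" "V z \<noteq> 0"
    "\<And>w. w \<in> ball z r \<Longrightarrow> f w = (w - z) ^ p * u w"
    "\<And>w. w \<in> ball z r \<Longrightarrow> M f w = (w - z) ^ (p * N - T) * V w"
    using M_order_at_zero[OF assms] by metis
  have "T \<le> p * N" using V(1) weight_less_degree by (cases p) auto
  then have split: "(w - z) ^ (p * N) = (w - z) ^ (p * N - T) * (w - z) ^ T" for w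
    by (simp add: power_add[symmetric])
  \<comment> \<open>What is left of M f - f^N after the common factor (w - z)^(p N - T) is
    cancelled; at z only V survives.\<close>
  define h where "h = (\<lambda>w. V w - (w - z) ^ T * u w ^ N)"
  have "h holomorphic_on ball z r" unfolding h_def by (intro holomorphic_intros V)
  moreover have "h w = 0" if w: "w \<in> ball z r - {z}" for w
  proof -
    have wb: "w \<in> ball z r" using w by simp
    have "(w - z) ^ (p * N - T) * V w = (w - z) ^ (p * N) * u w ^ N"
      unfolding V(7)[OF wb, symmetric] eq V(6)[OF wb] by (simp only: power_mult_distrib power_mult)
    then have "(w - z) ^ (p * N - T) * V w = (w - z) ^ (p * N - T) * ((w - z) ^ T * u w ^ N)"
      unfolding split by (simp only: mult.assoc)
    then show ?thesis using w by (simp add: h_def)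
  qed
  ultimately have "h z = 0" using holomorphic_eq_0_of_punctured_ball V(2) by blast
  then show False using V(5) T_pos by (simp add: h_def)
qed

end

subsection \<open>Rescaling on a level set\<close>

text \<open>Zalcman's maximisation, with only points of the level set compared. The weight 1 - dist
  w y vanishes on the boundary of the unit disc; this keeps the maximum inside and leaves room of
  radius A / 2 in the rescaled variable.\<close>

lemma rescaling_point:
  assumes f: "f holomorphic_on UNIV" and w: "cmod (f w) = 1" and A: "cmod (deriv f w) \<ge> A" "A > 0"
  obtains z \<rho> where "\<rho> > 0" "\<rho> \<le> 1 / A" "cmod (f z) = 1" "\<rho> * cmod (deriv f z) = 1"
    "\<And>\<zeta>. cmod \<zeta> < A / 2 \<Longrightarrow> cmod (f (of_real \<rho> * \<zeta> + z)) = 1 \<Longrightarrow>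
       \<rho> * cmod (deriv f (of_real \<rho> * \<zeta> + z)) \<le> 2"
proof -
  define S where "S = cball w 1 \<inter> (\<lambda>z. cmod (f z)) -` {1}"
  define \<phi> where "\<phi> = (\<lambda>z. (1 - dist w z) * cmod (deriv f z))"
  have cf: "continuous_on X f" and cdf: "continuous_on X (deriv f)" for X
    by (intro holomorphic_on_imp_continuous_on holomorphic_on_subset[OF f subset_UNIV]
          holomorphic_on_subset[OF holomorphic_deriv[OF f open_UNIV] subset_UNIV])+
  have "compact S"
    unfolding compact_eq_bounded_closed
  proof
    show "bounded S" unfolding S_def by (rule bounded_subset[OF bounded_cball]) auto
    show "closed S" unfolding S_def
      by (intro continuous_closed_preimage continuous_on_norm cf) auto
  qed
  moreover have wS: "w \<in> S" using w by (simp add: S_def)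
  moreover have "continuous_on S \<phi>" unfolding \<phi>_def by (intro continuous_intros cdf)
  ultimately obtain z where z: "z \<in> S" "\<And>y. y \<in> S \<Longrightarrow> \<phi> y \<le> \<phi> z"
    using continuous_attains_sup[of S \<phi>] by blast
  define d where "d = 1 - dist w z"
  have d: "0 \<le> d" "d \<le> 1" using z(1) by (auto simp: d_def S_def)
  have Ad: "A \<le> d * cmod (deriv f z)" using z(2)[OF wS] A by (simp add: \<phi>_def d_def)
  then have pos: "d > 0" "cmod (deriv f z) > 0" using A(2) d by (auto simp: less_le)
  define \<rho> where "\<rho> = 1 / cmod (deriv f z)"
  have \<rho>: "\<rho> > 0" using pos(2) by (simp add: \<rho>_def del: zero_less_norm_iff)
  have A\<rho>: "\<rho> * A \<le> d" using Ad pos(2) by (simp add: \<rho>_def pos_divide_le_eq del: zero_less_norm_iff)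
  show thesis
  proof (rule that[OF \<rho>, of z])
    show "\<rho> \<le> 1 / A" using A\<rho> d(2) A(2) by (simp add: pos_le_divide_eq)
    show "cmod (f z) = 1" using z(1) by (simp add: S_def)
    show "\<rho> * cmod (deriv f z) = 1" using pos by (simp add: \<rho>_def)
    fix \<zeta> assume \<zeta>: "cmod \<zeta> < A / 2" and lev: "cmod (f (of_real \<rho> * \<zeta> + z)) = 1"
    \<comment> \<open>Such a y lies within d / 2 of z, so its weight is still at least d / 2. This
      is the origin of the factor 2.\<close>
    define y where "y = of_real \<rho> * \<zeta> + z"
    have zy: "dist z y = \<rho> * cmod \<zeta>" using \<rho> by (simp add: y_def dist_norm norm_mult)
    also have "\<dots> \<le> \<rho> * (A / 2)" using \<zeta> \<rho> by (intro mult_left_mono) auto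
    also have "\<dots> \<le> d / 2" using A\<rho> by simp
    finally have wy: "dist w y \<le> 1 - d / 2" using dist_triangle[of w y z] by (simp add: d_def field_simps)
    then have "y \<in> S" using lev d(1) by (simp add: S_def y_def)
    have "d / 2 * cmod (deriv f y) \<le> (1 - dist w y) * cmod (deriv f y)"
      using wy by (intro mult_right_mono) auto
    also have "\<dots> \<le> d * cmod (deriv f z)" using z(2)[OF \<open>y \<in> S\<close>] by (simp add: \<phi>_def d_def)
    finally have "cmod (deriv f y) \<le> 2 * cmod (deriv f z)" using pos(1) by simp
    then show "\<rho> * cmod (deriv f (of_real \<rho> * \<zeta> + z)) \<le> 2"
      using pos(2) unfolding y_def[symmetric]
      by (simp add: \<rho>_def pos_divide_le_eq del: zero_less_norm_iff)
  qed
qed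

text \<open>The growth estimate takes the place of a bound on spherical derivatives: |G i 0| = 1 and
  the derivative bound 2 on the level set give |G i| \<le> exp (4 |\<zeta>|) on growing discs. The
  limit is nonconstant because |G i'(0)| = 1.\<close>

lemma Zalcman_level_set:
  assumes f: "f holomorphic_on UNIV"
    and unbounded: "\<And>K. \<exists>w. cmod (f w) = 1 \<and> cmod (deriv f w) > K"
  obtains z :: "nat \<Rightarrow> complex" and \<rho> :: "nat \<Rightarrow> real" and g where
    "\<And>i. \<rho> i > 0" "\<rho> \<longlonglongrightarrow> 0" "entire_limit (\<lambda>i \<zeta>. f (of_real (\<rho> i) * \<zeta> + z i)) g"
    "\<not> g constant_on UNIV" "\<And>\<zeta>. cmod (g \<zeta>) \<le> exp (4 * cmod \<zeta>)"
proof -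
  have "\<exists>z \<rho>. \<rho> > 0 \<and> \<rho> \<le> 1 / (real i + 1) \<and> cmod (f z) = 1 \<and> \<rho> * cmod (deriv f z) = 1 \<and>
    (\<forall>\<zeta>. cmod \<zeta> < (real i + 1) / 2 \<and> cmod (f (of_real \<rho> * \<zeta> + z)) = 1 \<longrightarrow>
       \<rho> * cmod (deriv f (of_real \<rho> * \<zeta> + z)) \<le> 2)" for i
  proof -
    obtain w where w: "cmod (f w) = 1" "cmod (deriv f w) > real i + 1" using unbounded by blast
    show ?thesis
      by (rule rescaling_point[OF f w(1) less_imp_le[OF w(2)]]) (auto intro!: exI)
  qed
  then obtain z \<rho> where \<rho>: "\<And>i. \<rho> i > 0" "\<And>i. \<rho> i \<le> 1 / (real i + 1)"
    and z: "\<And>i. cmod (f (z i)) = 1" "\<And>i. \<rho> i * cmod (deriv f (z i)) = 1"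
    and lev: "\<And>i \<zeta>. cmod \<zeta> < (real i + 1) / 2 \<Longrightarrow> cmod (f (of_real (\<rho> i) * \<zeta> + z i)) = 1 \<Longrightarrow>
       \<rho> i * cmod (deriv f (of_real (\<rho> i) * \<zeta> + z i)) \<le> 2" by metis
  define G where "G = (\<lambda>i \<zeta>. f (of_real (\<rho> i) * \<zeta> + z i))"
  have dG: "(G i has_field_derivative of_real (\<rho> i) * deriv f (of_real (\<rho> i) * \<zeta> + z i)) (at \<zeta>)" for i \<zeta>
  proof -
    have "((\<lambda>\<zeta>. of_real (\<rho> i) * \<zeta> + z i) has_field_derivative of_real (\<rho> i)) (at \<zeta>)"
      by (auto intro!: derivative_eq_intros)
    then have "((\<lambda>\<zeta>. f (of_real (\<rho> i) * \<zeta> + z i)) has_field_derivative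
        deriv f (of_real (\<rho> i) * \<zeta> + z i) * of_real (\<rho> i)) (at \<zeta>)"
      by (rule DERIV_chain2[OF holomorphic_derivI[OF f open_UNIV UNIV_I]])
    then show ?thesis by (simp add: G_def mult.commute)
  qed
  then have G: "G i holomorphic_on UNIV" for i by (auto simp: holomorphic_on_open)
  have nd: "cmod (deriv (G i) \<zeta>) = \<rho> i * cmod (deriv f (of_real (\<rho> i) * \<zeta> + z i))" for i \<zeta>
    using DERIV_imp_deriv[OF dG] \<rho>(1)[of i] by (simp add: norm_mult)
  have growth: "cmod (G i \<zeta>) \<le> exp (4 * cmod \<zeta>)" if "cmod \<zeta> < (real i + 1) / 4" for i \<zeta>
  proof (cases "cmod (G i \<zeta>) > 1")
    case True
    have "ln (cmod (G i \<zeta>)) \<le> 2 * 2 * dist \<zeta> 0"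
    proof (rule ln_norm_le_of_level_deriv_bound(1))
      show "G i holomorphic_on ball 0 ((real i + 1) / 2)" using G holomorphic_on_subset by blast
      \<comment> \<open>The disc around \<zeta> through 0 reaches out to 2 |\<zeta>|; hence growth
        is claimed only for |\<zeta>| < (i + 1) / 4.\<close>
      show "cball \<zeta> (dist \<zeta> 0) \<subseteq> ball 0 ((real i + 1) / 2)"
      proof
        fix x assume "x \<in> cball \<zeta> (dist \<zeta> 0)"
        then have "cmod (x - \<zeta>) \<le> cmod \<zeta>" by (simp add: dist_norm norm_minus_commute)
        then have "cmod x \<le> 2 * cmod \<zeta>" using norm_triangle_ineq[of "x - \<zeta>" \<zeta>] by simp
        then show "x \<in> ball 0 ((real i + 1) / 2)" using that by simp
      qed
      show "cmod (G i 0) \<le> 1" using z(1)[of i] by (simp add: G_def)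
      show "cmod (deriv (G i) x) \<le> 2" if "x \<in> ball 0 ((real i + 1) / 2)" "cmod (G i x) = 1" for x
        using lev[of x i] that by (simp add: nd) (simp add: G_def)
    qed (use True in auto)
    then show ?thesis using True ln_le_cancel_iff[of "cmod (G i \<zeta>)" "exp (4 * cmod \<zeta>)"]
      by (simp del: zero_less_norm_iff)
  next
    case False
    then show ?thesis using order_trans[of "cmod (G i \<zeta>)" 1 "exp (4 * cmod \<zeta>)"] by simp
  qed
  have evg: "eventually (\<lambda>i. R < (real i + 1) / 4) sequentially" for R
  proof -
    have "eventually (\<lambda>i. 4 * R < real i) sequentially"
      using filterlim_real_sequentially unfolding filterlim_at_top_dense by blast
    then show ?thesis by eventually_elim simp
  qed
  have bdd: "\<exists>B. eventually (\<lambda>i. \<forall>\<zeta>\<in>cball 0 R. cmod (G i \<zeta>) \<le> B) sequentially" for R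
  proof -
    have "eventually (\<lambda>i. \<forall>\<zeta>\<in>cball 0 R. cmod (G i \<zeta>) \<le> exp (4 * R)) sequentially"
      using evg[of R]
    proof (eventually_elim, intro ballI)
      fix i \<zeta> assume i: "R < (real i + 1) / 4" and \<zeta>: "\<zeta> \<in> cball (0::complex) R"
      have "cmod (G i \<zeta>) \<le> exp (4 * cmod \<zeta>)" using i \<zeta> by (intro growth) simp
      also have "\<dots> \<le> exp (4 * R)" using \<zeta> by simp
      finally show "cmod (G i \<zeta>) \<le> exp (4 * R)" .
    qed
    then show ?thesis by blast
  qed
  obtain g r where r: "strict_mono r" and lim: "entire_limit (\<lambda>i. G (r i)) g"
    using Montel_entire[OF G bdd] by metis
  have evr: "eventually (\<lambda>i. R < (real (r i) + 1) / 4) sequentially" for R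
    using eventually_subseq[OF r evg[of R]] by simp
  show thesis
  proof (rule that[of "\<lambda>i. \<rho> (r i)" "\<lambda>i. z (r i)" g])
    show "(\<lambda>i. \<rho> (r i)) \<longlonglongrightarrow> 0"
    proof -
      have lim0: "(\<lambda>i. 1 / (real i + 1)) \<longlonglongrightarrow> 0"
        using LIMSEQ_inverse_real_of_nat by (simp add: inverse_eq_divide add.commute)
      have "\<rho> \<longlonglongrightarrow> 0"
        by (rule tendsto_sandwich[OF _ _ tendsto_const lim0])
           (auto intro!: always_eventually less_imp_le[OF \<rho>(1)] \<rho>(2))
      then show ?thesis using LIMSEQ_subseq_LIMSEQ[OF _ r] by (simp add: o_def)
    qed
    show "entire_limit (\<lambda>i \<zeta>. f (of_real (\<rho> (r i)) * \<zeta> + z (r i))) g" using lim by (simp add: G_def)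
    show "cmod (g \<zeta>) \<le> exp (4 * cmod \<zeta>)" for \<zeta>
    proof (rule tendsto_upperbound[OF tendsto_norm[OF entire_limit_pointwise[OF lim]]])
      show "eventually (\<lambda>i. cmod (G (r i) \<zeta>) \<le> exp (4 * cmod \<zeta>)) sequentially"
        using evr[of "cmod \<zeta>"] by eventually_elim (rule growth)
    qed simp
    have "(\<lambda>i. cmod (deriv (G (r i)) 0)) \<longlonglongrightarrow> cmod (deriv g 0)"
      by (intro tendsto_norm entire_limit_pointwise[OF entire_limit_deriv[OF lim]])
    moreover have "cmod (deriv (G (r i)) 0) = 1" for i using nd z(2) by simp
    ultimately have d1: "cmod (deriv g 0) = 1" by (simp add: LIMSEQ_const_iff)
    show "\<not> g constant_on UNIV"
    proof
      assume "g constant_on UNIV"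
      then obtain c where "g = (\<lambda>_. c)" by (auto simp: constant_on_def)
      then show False using d1 by simp
    qed
  qed (use \<rho> in auto)
qed

section \<open>Zero-free quotients of entire functions with the same zeros\<close>

lemma entire_zero_iff_tendsto:
  assumes "F holomorphic_on UNIV"
  shows "F \<midarrow>z\<rightarrow> 0 \<longleftrightarrow> F z = (0::complex)"
proof -
  have "isCont F z"
    using holomorphic_on_imp_continuous_on[OF assms] by (simp add: continuous_on_eq_continuous_at)
  then have "F \<midarrow>z\<rightarrow> F z" by (rule isContD)
  then show ?thesis using LIM_unique by force
qed

lemma same_zeros_entire_quotient:
  assumes F: "F holomorphic_on UNIV" and G: "G holomorphic_on UNIV"
    and same: "F \<rightleftharpoons> G" and nz: "F w0 \<noteq> 0"
  obtains E where "E holomorphic_on UNIV" "\<And>z. E z \<noteq> 0" "\<And>z. G z = E z * F z"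
proof -
  have zero_iff: "F z = 0 \<longleftrightarrow> G z = 0" for z
    using same entire_zero_iff_tendsto[OF F, of z] entire_zero_iff_tendsto[OF G, of z]
    by (simp add: same_zeros_poles_def)
  have Gw: "G w0 \<noteq> 0" using zero_iff nz by blast
  have zord: "zorder F z = zorder G z" if "F z = 0" for z
    using same entire_zero_iff_tendsto[OF F, of z] that by (simp add: same_zeros_poles_def)
  \<comment> \<open>At a common zero the equal powers of w - z cancel, and the quotient of the
    nonvanishing cofactors is the correct value. This is where multiplicities enter.\<close>
  define E where "E = (\<lambda>z. if F z \<noteq> 0 then G z / F z else zor_poly G z z / zor_poly F z z)"
  have loc: "E field_differentiable at z \<and> E z \<noteq> 0" for z
  proof (cases "F z = 0")
    case True
    let ?m = "nat (zorder F z)"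
    obtain r where r: "r > 0" "zor_poly F z holomorphic_on cball z r"
        "\<And>w. w \<in> cball z r \<Longrightarrow> F w = zor_poly F z w * (w - z) ^ ?m \<and> zor_poly F z w \<noteq> 0"
      using zorder_exist_zero[OF F open_UNIV connected_UNIV UNIV_I, of z] nz by (meson UNIV_I)
    obtain s where s: "s > 0" "zor_poly G z holomorphic_on cball z s"
        "\<And>w. w \<in> cball z s \<Longrightarrow> G w = zor_poly G z w * (w - z) ^ ?m \<and> zor_poly G z w \<noteq> 0"
      using zorder_exist_zero[OF G open_UNIV connected_UNIV UNIV_I, of z] Gw
      unfolding zord[OF True] by (meson UNIV_I)
    define t where "t = min r s"
    have t: "t > 0" "ball z t \<subseteq> cball z r" "ball z t \<subseteq> cball z s" using r s by (auto simp: t_def)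
    have "(\<lambda>w. zor_poly G z w / zor_poly F z w) holomorphic_on ball z t"
      by (intro holomorphic_intros holomorphic_on_subset[OF r(2) t(2)] holomorphic_on_subset[OF s(2) t(3)])
         (use r(3) t(2) in blast)
    moreover have "zor_poly G z w / zor_poly F z w = E w" if w: "w \<in> ball z t" for w
    proof (cases "w = z")
      case True
      then show ?thesis using \<open>F z = 0\<close> by (simp add: E_def)
    next
      case False
      have "F w = zor_poly F z w * (w - z) ^ ?m" "zor_poly F z w \<noteq> 0"
        "G w = zor_poly G z w * (w - z) ^ ?m"
        using r(3)[of w] s(3)[of w] w t by auto
      then show ?thesis using False by (simp add: E_def)
    qed
    ultimately have "E holomorphic_on ball z t" by (rule holomorphic_transform)
    then have "E field_differentiable at z"
      using t(1) by (intro holomorphic_on_imp_differentiable_at[of _ "ball z t"]) auto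
    moreover have "E z \<noteq> 0" using True r(3)[of z] s(3)[of z] r(1) s(1) by (simp add: E_def)
    ultimately show ?thesis by blast
  next
    case False
    have "isCont F z"
      using holomorphic_on_imp_continuous_on[OF F] by (simp add: continuous_on_eq_continuous_at)
    then obtain t where t: "t > 0" "\<And>w. dist z w < t \<Longrightarrow> F w \<noteq> 0"
      using continuous_at_avoid[of z F 0] False by auto
    have "(\<lambda>w. G w / F w) holomorphic_on ball z t"
      by (intro holomorphic_intros holomorphic_on_subset[OF F] holomorphic_on_subset[OF G]) (use t in auto)
    then have "E holomorphic_on ball z t"
      by (rule holomorphic_transform) (use t in \<open>simp add: E_def\<close>)
    then have "E field_differentiable at z"
      using t(1) by (intro holomorphic_on_imp_differentiable_at[of _ "ball z t"]) auto
    then show ?thesis using False zero_iff[of z] by (simp add: E_def)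
  qed
  show thesis
  proof (rule that[of E])
    show "E holomorphic_on UNIV"
      using loc by (auto simp: holomorphic_on_def intro: field_differentiable_at_within)
    show "G z = E z * F z" for z using zero_iff[of z] by (auto simp: E_def)
  qed (use loc in blast)
qed

lemma entire_power_const_imp_const:
  assumes "g holomorphic_on UNIV" "\<And>z. g z ^ d = c" "d > 0"
  shows "g constant_on UNIV"
proof -
  have "bounded (range g)"
    unfolding bounded_iff
  proof (intro exI ballI)
    fix y assume "y \<in> range g"
    then have y: "cmod y ^ d = cmod c" using assms(2) by (auto simp: norm_power[symmetric])
    show "cmod y \<le> max 1 (cmod c)"
      using assms(3) self_le_power[of "cmod y" d] y by linarith
  qed
  then show ?thesis using Liouville_theorem[OF assms(1)] by blast
qed

section \<open>Bounding f' on the unit level set of f\<close>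

locale shared_value = monomial_exponents +
  fixes f :: "complex \<Rightarrow> complex" and a b :: complex
  assumes a_nz: "a \<noteq> 0" and b_nz: "b \<noteq> 0"
    and f_entire: "f holomorphic_on UNIV" and f_nonconst: "\<not> f constant_on UNIV"
    and shared: "(\<lambda>z. f z ^ N - a) \<rightleftharpoons> (\<lambda>z. M f z - b)"
begin

lemma F_entire: "(\<lambda>z. f z ^ N - a) holomorphic_on UNIV"
  by (intro holomorphic_intros f_entire)

lemma G_entire: "(\<lambda>z. M f z - b) holomorphic_on UNIV"
  by (intro holomorphic_on_diff M_holomorphic f_entire holomorphic_on_const)

lemma shared_iff: "f z ^ N = a \<longleftrightarrow> M f z = b"
  using shared entire_zero_iff_tendsto[OF F_entire, of z] entire_zero_iff_tendsto[OF G_entire, of z]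
  by (simp add: same_zeros_poles_def)

lemma level_deriv_bound: "\<exists>K\<ge>0. \<forall>\<zeta>. cmod (f \<zeta>) = 1 \<longrightarrow> cmod (deriv f \<zeta>) \<le> K"
proof (rule ccontr)
  assume neg: "\<not> ?thesis"
  have unb: "\<exists>w. cmod (f w) = 1 \<and> cmod (deriv f w) > K" for K
  proof -
    obtain w where "cmod (f w) = 1" "\<not> cmod (deriv f w) \<le> max 0 K"
      using neg by (meson max.cobounded1)
    then show ?thesis by (intro exI[of _ w]) auto
  qed
  obtain z \<rho> g where \<rho>: "\<And>i. \<rho> i > 0" "\<rho> \<longlonglongrightarrow> 0"
    and lim: "entire_limit (\<lambda>i \<zeta>. f (of_real (\<rho> i) * \<zeta> + z i)) g"
    and g: "\<not> g constant_on UNIV" "\<And>\<zeta>. cmod (g \<zeta>) \<le> exp (4 * cmod \<zeta>)"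
    by (rule Zalcman_level_set[OF f_entire unb]) (rule that, assumption+)
  define G where "G = (\<lambda>i \<zeta>. f (of_real (\<rho> i) * \<zeta> + z i))"
  note lim = lim[folded G_def]
  note g_entire = entire_limitD(2)[OF lim]
  have MG: "M (G i) \<zeta> = of_real (\<rho> i) ^ T * M f (of_real (\<rho> i) * \<zeta> + z i)" for i \<zeta>
    using M_compose_affine[OF f_entire, of "of_real (\<rho> i)" "z i" 1 \<zeta>] by (simp add: G_def)
  have limF: "entire_limit (\<lambda>i \<zeta>. G i \<zeta> ^ N - a) (\<lambda>\<zeta>. g \<zeta> ^ N - a)"
    by (intro entire_limit_diff entire_limit_power lim entire_limit_const tendsto_const)
  \<comment> \<open>The T derivatives in M turn the shared value b into \<rho>^T b, while a stays
    fixed; T > 0 makes the former vanish in the limit.\<close>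
  have "(\<lambda>i. of_real (\<rho> i) ^ T * b) \<longlonglongrightarrow> of_real 0 ^ T * b"
    by (intro tendsto_intros \<rho>(2))
  then have "(\<lambda>i. of_real (\<rho> i) ^ T * b) \<longlonglongrightarrow> 0" using T_pos by (simp add: zero_power)
  then have "entire_limit (\<lambda>i \<zeta>. M (G i) \<zeta> - of_real (\<rho> i) ^ T * b) (\<lambda>\<zeta>. M g \<zeta> - 0)"
    by (intro entire_limit_diff M_entire_limit lim entire_limit_const)
  then have limM: "entire_limit (\<lambda>i \<zeta>. M (G i) \<zeta> - of_real (\<rho> i) ^ T * b) (M g)" by simp
  have iff: "G i \<zeta> ^ N - a = 0 \<longleftrightarrow> M (G i) \<zeta> - of_real (\<rho> i) ^ T * b = 0" for i \<zeta>
    using shared_iff[of "of_real (\<rho> i) * \<zeta> + z i"] \<rho>(1)[of i] by (simp add: MG) (simp add: G_def)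
  \<comment> \<open>At a zero of g also M g vanishes, and M g is not constant there. Hurwitz'
    theorem from the side of M would give g^N = a at that point.\<close>
  have nz: "g \<zeta> \<noteq> 0" for \<zeta>
  proof
    assume 0: "g \<zeta> = 0"
    have "g \<zeta> ^ N - a = 0"
      by (rule entire_limit_shared_zeros[OF limM limF _ M_not_constant[OF g_entire g(1) 0] M_zero[OF g_entire 0]])
         (rule iffD2[OF iff])
    then show False using 0 N_pos a_nz by (simp add: zero_power)
  qed
  obtain l m where lm: "\<And>z. g z = exp (l * z + m)"
    using nonvanishing_entire_exponential_type[OF g_entire nz, of 1 4] g(2) by auto
  have l: "l \<noteq> 0" using g(1) lm by (auto simp: constant_on_def)
  have geq: "g = (\<lambda>z. exp m * exp (l * z))" using lm by (auto simp: exp_add mult.commute)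
  \<comment> \<open>A point where g^N = a. Hurwitz' theorem from the side of F forces M g = 0 there,
    whereas the exponential form of g gives \<open>exp_coeff l * a\<close>.\<close>
  define \<zeta> where "\<zeta> = (Ln a / of_nat N - m) / l"
  have "g \<zeta> = exp (Ln a / of_nat N)" using l by (simp add: lm \<zeta>_def)
  then have "g \<zeta> ^ N = exp (of_nat N * (Ln a / of_nat N))" by (simp only: exp_of_nat_mult)
  also have "of_nat N * (Ln a / of_nat N) = Ln a" using of_nat_N_nz by (rule nonzero_mult_div_cancel_left[THEN trans[OF times_divide_eq_right]])
  finally have g\<zeta>: "g \<zeta> ^ N = a" using a_nz by simp
  have nc: "\<not> (\<lambda>\<zeta>. g \<zeta> ^ N - a) constant_on UNIV"
  proof
    assume "(\<lambda>\<zeta>. g \<zeta> ^ N - a) constant_on UNIV"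
    then have "g x ^ N - a = g \<zeta> ^ N - a" for x by (metis (no_types, lifting) UNIV_I constant_on_def)
    then have c: "g x ^ N = a" for x using g\<zeta> by simp
    then show False using entire_power_const_imp_const[OF g_entire c N_pos] g(1) by blast
  qed
  have "M g \<zeta> = 0"
    by (rule entire_limit_shared_zeros[OF limF limM iffD1[OF iff] nc]) (use g\<zeta> in auto)
  moreover have "M g \<zeta> = exp_coeff l * a"
    using M_exp[of "exp m" l \<zeta>] g\<zeta> unfolding geq by simp
  ultimately show False using l a_nz exp_coeff_eq_0_iff by simp
qed

end

subsection \<open>The quotient of the two shared functions\<close>

text \<open>Compactness of the Riemann sphere; in the second alternative the whole sequence
  escapes.\<close>

lemma subseq_convergent_or_at_top:
  fixes c :: "nat \<Rightarrow> complex"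
  obtains r L where "strict_mono (r :: nat \<Rightarrow> nat)" "(\<lambda>i. c (r i)) \<longlonglongrightarrow> L"
  | "filterlim (\<lambda>i. cmod (c i)) at_top sequentially"
proof (cases "filterlim (\<lambda>i. cmod (c i)) at_top sequentially")
  case False
  then obtain B where B: "\<not> eventually (\<lambda>i. B \<le> cmod (c i)) sequentially"
    by (auto simp: filterlim_at_top)
  then obtain r where r: "strict_mono (r :: nat \<Rightarrow> nat)" "\<And>i. \<not> B \<le> cmod (c (r i))"
    using not_eventually_sequentiallyD by blast
  have "bounded (range (\<lambda>i. c (r i)))"
    unfolding bounded_iff using r(2) by (intro exI[of _ B]) (auto simp: not_le less_imp_le)
  then obtain L r' where r': "strict_mono (r' :: nat \<Rightarrow> nat)" "((\<lambda>i. c (r i)) \<circ> r') \<longlonglongrightarrow> L"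
    using bounded_imp_convergent_subsequence by blast
  then show thesis
    using that(1)[OF strict_mono_o[OF r(1) r'(1)], of L] by (simp add: o_def)
qed (use that in blast)

lemma translate_entire: "h holomorphic_on UNIV \<Longrightarrow> (\<lambda>\<zeta>. h (\<zeta> + w)) holomorphic_on UNIV" for w :: complex
  using holomorphic_on_compose_gen[of "\<lambda>\<zeta>. \<zeta> + w" UNIV h UNIV] by (simp add: o_def holomorphic_intros)

lemma deriv_translate: "h holomorphic_on UNIV \<Longrightarrow> deriv (\<lambda>\<zeta>. h (\<zeta> + w)) x = deriv h (x + w)" for w :: complex
  using higher_deriv_compose_affine[of h 1 1 1 w x] by simp

context shared_value
begin

text \<open>The floor 1 keeps 1 / \<kappa> bounded and leaves f untouched where |f| \<le> 1.\<close>

definition \<kappa> :: "complex \<Rightarrow> real" where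
  "\<kappa> z = max 1 (cmod (f z))"

lemma \<kappa>_ge_1: "\<kappa> z \<ge> 1"
  by (simp add: \<kappa>_def)

definition resc :: "complex \<Rightarrow> complex \<Rightarrow> complex" where
  "resc z \<zeta> = f (\<zeta> + z) / of_real (\<kappa> z)"

definition inv_scale :: "complex \<Rightarrow> complex" where
  "inv_scale z = 1 / of_real (\<kappa> z)"

text \<open>Translates of \<open>f\<close>, normalised so that unbounded sequences of values are treated on the same
  footing as bounded ones: the limit \<open>s\<close> of \<open>1 / \<kappa>\<close> is \<open>0\<close> in the former case.\<close>
lemma rescaled_sequence:
  obtains r g s where "strict_mono (r :: nat \<Rightarrow> nat)"
    "entire_limit (\<lambda>i. resc (z (r i))) g"
    "(\<lambda>i. inv_scale (z (r i))) \<longlonglongrightarrow> s" "s = 0 \<Longrightarrow> cmod (g 0) = 1"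
proof -
  obtain K where K: "K \<ge> 0" "\<And>\<zeta>. cmod (f \<zeta>) = 1 \<Longrightarrow> cmod (deriv f \<zeta>) \<le> K"
    using level_deriv_bound by blast
  define G where "G = (\<lambda>i. resc (z i))"
  have G: "G i holomorphic_on UNIV" for i
    unfolding G_def resc_def[abs_def] using \<kappa>_ge_1[of "z i"]
    by (intro holomorphic_on_divide holomorphic_on_const translate_entire f_entire) auto
  have "cmod (G i \<zeta>) \<le> exp (8 * K * cmod \<zeta>)" for i \<zeta>
    using entire_growth_of_level_deriv_bound[OF f_entire K(2) K(1), of "\<zeta> + z i" "z i"] \<kappa>_ge_1[of "z i"]
    by (simp add: G_def resc_def norm_divide \<kappa>_def[symmetric] dist_norm pos_divide_le_eq mult.commute)
  then have "cmod (G i \<zeta>) \<le> exp (8 * K * R)" if "\<zeta> \<in> cball 0 R" for i \<zeta> R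
  proof -
    have "8 * K * cmod \<zeta> \<le> 8 * K * R" using that K(1) by (intro mult_left_mono) auto
    then show ?thesis using \<open>cmod (G i \<zeta>) \<le> exp (8 * K * cmod \<zeta>)\<close> order_trans exp_le_cancel_iff by blast
  qed
  then have bdd: "\<exists>B. eventually (\<lambda>i. \<forall>\<zeta>\<in>cball 0 R. cmod (G i \<zeta>) \<le> B) sequentially" for R
    by (intro exI[of _ "exp (8 * K * R)"] always_eventually) blast
  obtain g r where r: "strict_mono r" and lim: "entire_limit (\<lambda>i. G (r i)) g"
    by (rule Montel_entire[OF G bdd]) (rule that, assumption+)
  have inv: "1 / \<kappa> x \<le> 1" for x using \<kappa>_ge_1[of x] by simp
  have "bounded (range (\<lambda>i. inv_scale (z (r i))))"
    unfolding bounded_iff inv_scale_def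
    by (intro exI[of _ 1]) (use inv \<kappa>_ge_1 in \<open>auto simp: norm_divide abs_of_nonneg order_trans[OF zero_le_one]\<close>)
  then obtain s r' where r': "strict_mono (r' :: nat \<Rightarrow> nat)"
    and s: "((\<lambda>i. inv_scale (z (r i))) \<circ> r') \<longlonglongrightarrow> s"
    using bounded_imp_convergent_subsequence by blast
  have lim': "entire_limit (\<lambda>i. G (r (r' i))) g" by (rule entire_limit_subseq[OF lim r'])
  show thesis
  proof (rule that[of "r \<circ> r'" g s])
    show "strict_mono (r \<circ> r')" by (rule strict_mono_o[OF r r'])
    show "entire_limit (\<lambda>i. resc (z ((r \<circ> r') i))) g"
      using lim' by (simp add: G_def)
    show "(\<lambda>i. inv_scale (z ((r \<circ> r') i))) \<longlonglongrightarrow> s" using s by (simp add: o_def)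
    show "cmod (g 0) = 1" if "s = 0"
    proof -
      \<comment> \<open>A small 1 / \<kappa> means \<kappa> > 1, so \<kappa> = |f| and the
        normalised function has modulus 1 at 0.\<close>
      have "eventually (\<lambda>i. dist (inv_scale (z (r (r' i)))) 0 < 1) sequentially"
        using s that by (intro tendstoD) (simp_all add: o_def)
      then have "eventually (\<lambda>i. cmod (G (r (r' i)) 0) = 1) sequentially"
      proof eventually_elim
        case (elim i)
        then have "\<kappa> (z (r (r' i))) > 1" using \<kappa>_ge_1[of "z (r (r' i))"] by (simp add: inv_scale_def norm_divide)
        then have "\<kappa> (z (r (r' i))) = cmod (f (z (r (r' i))))" "cmod (f (z (r (r' i)))) > 1"
          by (auto simp: \<kappa>_def)
        then have "\<kappa> (z (r (r' i))) = cmod (f (z (r (r' i))))" "f (z (r (r' i))) \<noteq> 0" by auto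
        then show ?case by (simp add: G_def resc_def norm_divide)
      qed
      then have "(\<lambda>i. cmod (G (r (r' i)) 0)) \<longlonglongrightarrow> 1" by (rule tendsto_eventually)
      moreover have "(\<lambda>i. cmod (G (r (r' i)) 0)) \<longlonglongrightarrow> cmod (g 0)"
        by (intro tendsto_norm entire_limit_pointwise[OF lim'])
      ultimately show ?thesis by (rule LIMSEQ_unique[symmetric])
    qed
  qed
qed

end

locale shared_quotient = shared_value +
  fixes E :: "complex \<Rightarrow> complex"
  assumes E_entire: "E holomorphic_on UNIV" and E_nz: "E z \<noteq> 0"
    and E_eq: "M f z - b = E z * (f z ^ N - a)"
begin

text \<open>Both sides of \<open>E_eq\<close> are divided by \<kappa>^N, by the common degree N; E
  itself is only translated.\<close>

lemma rescaled_eq: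
  "E (\<zeta> + z) * (resc z \<zeta> ^ N - a * inv_scale z ^ N) = M (resc z) \<zeta> - b * inv_scale z ^ N"
proof -
  have "M (resc z) \<zeta> = inv_scale z ^ N * M f (\<zeta> + z)"
    using M_compose_affine[OF f_entire, of 1 z "of_real (\<kappa> z)" \<zeta>]
    by (simp add: resc_def[abs_def] inv_scale_def power_divide)
  moreover have "resc z \<zeta> ^ N = inv_scale z ^ N * f (\<zeta> + z) ^ N"
    by (simp add: resc_def inv_scale_def power_divide)
  ultimately have "M (resc z) \<zeta> - b * inv_scale z ^ N = inv_scale z ^ N * (M f (\<zeta> + z) - b)"
    "resc z \<zeta> ^ N - a * inv_scale z ^ N = inv_scale z ^ N * (f (\<zeta> + z) ^ N - a)"
    by (simp_all add: algebra_simps)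
  then show ?thesis by (simp only: E_eq mult_ac)
qed

lemma rescaled_limit_functions:
  assumes g: "entire_limit (\<lambda>i. resc (z i)) g" and s: "(\<lambda>i. inv_scale (z i)) \<longlonglongrightarrow> s"
  shows "entire_limit (\<lambda>i \<zeta>. M (resc (z i)) \<zeta> - b * inv_scale (z i) ^ N) (\<lambda>\<zeta>. M g \<zeta> - b * s ^ N)"
    and "entire_limit (\<lambda>i \<zeta>. resc (z i) \<zeta> ^ N - a * inv_scale (z i) ^ N) (\<lambda>\<zeta>. g \<zeta> ^ N - a * s ^ N)"
  by (intro entire_limit_diff entire_limit_power M_entire_limit g entire_limit_const tendsto_intros s)+

text \<open>The degenerate case, in which the limit of the denominators vanishes identically. Then s
  = 0 would give g 0 = 0, against the normalisation.\<close>

lemma limit_constant: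
  assumes g: "g holomorphic_on UNIV" and s: "s = 0 \<Longrightarrow> cmod (g 0) = 1"
    and eq: "\<And>\<zeta>. g \<zeta> ^ N = a * s ^ N"
  shows "s \<noteq> 0" "\<exists>\<gamma>. g = (\<lambda>_. \<gamma>)" "M g \<zeta> = 0"
proof -
  show "s \<noteq> 0" using s eq[of 0] N_pos by (auto simp: zero_power)
  obtain \<gamma> where "g = (\<lambda>_. \<gamma>)"
    using entire_power_const_imp_const[OF g eq N_pos] by (auto simp: constant_on_def)
  then show "\<exists>\<gamma>. g = (\<lambda>_. \<gamma>)" "M g \<zeta> = 0" using M_const by auto
qed

lemma E_level_deriv_bound: "\<exists>K\<ge>0. \<forall>\<zeta>. cmod (E \<zeta>) = 1 \<longrightarrow> cmod (deriv E \<zeta>) \<le> K"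
proof (rule ccontr)
  assume neg: "\<not> ?thesis"
  have "\<exists>w. cmod (E w) = 1 \<and> cmod (deriv E w) > real i" for i
    using neg by (meson not_le of_nat_0_le_iff)
  then obtain z where z: "\<And>i. cmod (E (z i)) = 1" "\<And>i. cmod (deriv E (z i)) > real i" by metis
  obtain r g s where r: "strict_mono r" and g: "entire_limit (\<lambda>i. resc (z (r i))) g"
    and s: "(\<lambda>i. inv_scale (z (r i))) \<longlonglongrightarrow> s" "s = 0 \<Longrightarrow> cmod (g 0) = 1"
    by (rule rescaled_sequence[of z]) (rule that, assumption+)
  note lim = rescaled_limit_functions[OF g s(1)]
  show False
  proof (cases "\<exists>w. g w ^ N - a * s ^ N \<noteq> 0")
    case True
    then obtain w where w: "g w ^ N - a * s ^ N \<noteq> 0" by blast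
    obtain B where B: "eventually (\<lambda>i. cmod (E (0 + z (r i))) \<le> B \<and>
        cmod (deriv (\<lambda>\<zeta>. E (\<zeta> + z (r i))) 0) \<le> B) sequentially"
      using entire_limit_quotient_bounded[OF lim translate_entire[OF E_entire] rescaled_eq w] by blast
    obtain j where j: "real j > B" using reals_Archimedean2 by blast
    have "eventually (\<lambda>i. i \<ge> j) sequentially" by (rule eventually_ge_at_top)
    with B have "eventually (\<lambda>i. False) sequentially"
    proof eventually_elim
      case (elim i)
      have "real j \<le> real (r i)" using elim(2) seq_suble[OF r, of i] by simp
      then show ?case using elim(1) z(2)[of "r i"] j by (simp add: deriv_translate[OF E_entire])
    qed
    then show False by simp
  next
    case False
    then have eq: "g \<zeta> ^ N = a * s ^ N" for \<zeta> by simp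
    note c = limit_constant[OF entire_limitD(2)[OF g] s(2) eq]
    \<comment> \<open>In the degenerate case |E| = 1 equates the moduli of both sides of
      \<open>rescaled_eq\<close> at 0. In the limit this reads |b s^N| = 0.\<close>
    have "cmod (M (resc (z (r i))) 0 - b * inv_scale (z (r i)) ^ N) =
        cmod (resc (z (r i)) 0 ^ N - a * inv_scale (z (r i)) ^ N)" for i
      unfolding rescaled_eq[symmetric] using z(1)[of "r i"] by (simp add: norm_mult)
    then have "(\<lambda>i. cmod (resc (z (r i)) 0 ^ N - a * inv_scale (z (r i)) ^ N)) \<longlonglongrightarrow> cmod (M g 0 - b * s ^ N)"
      using tendsto_norm[OF entire_limit_pointwise[OF lim(1), of 0]] by simp
    then have "cmod (M g 0 - b * s ^ N) = cmod (g 0 ^ N - a * s ^ N)"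
      using tendsto_norm[OF entire_limit_pointwise[OF lim(2), of 0]] LIMSEQ_unique by blast
    then show False using c b_nz eq by simp
  qed
qed

lemma E_exp: obtains \<alpha> \<beta> where "\<And>z. E z = exp (\<alpha> * z + \<beta>)"
proof -
  obtain K where K: "K \<ge> 0" "\<And>\<zeta>. cmod (E \<zeta>) = 1 \<Longrightarrow> cmod (deriv E \<zeta>) \<le> K"
    using E_level_deriv_bound by blast
  have "cmod (E z) \<le> max 1 (cmod (E 0)) * exp (8 * K * cmod z)" for z
    using entire_growth_of_level_deriv_bound[OF E_entire K(2) K(1), of z 0] by simp
  then show thesis
    using nonvanishing_entire_exponential_type[OF E_entire E_nz _ _ that] K(1) by force
qed

section \<open>Exclusion of a nonconstant exponential quotient\<close>

context
  fixes \<alpha> \<beta> :: complex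
  assumes E_exp_eq: "\<And>z. E z = exp (\<alpha> * z + \<beta>)" and \<alpha>_nz: "\<alpha> \<noteq> 0"
begin

lemma E_translate: "E (\<zeta> + z) = E z * exp (\<alpha> * \<zeta>)"
  by (simp only: E_exp_eq exp_add distrib_left mult_ac)

lemma Q_exists:
  obtains Q where "Q holomorphic_on UNIV" "\<And>z. Q z * f z = deriv f z * (E z - b / a)"
proof -
  obtain M1 where M1: "M1 holomorphic_on UNIV" "\<And>z. M f z = f z * M1 z"
    using M_factor[OF f_entire] by blast
  obtain e where e: "N = Suc e" using gr0_implies_Suc[OF N_pos] by blast
  \<comment> \<open>One factor f is cancelled from a E - b = E f^N - M f, so that no division by f
    remains.\<close>
  define Q where "Q = (\<lambda>z. deriv f z * (E z * f z ^ e - M1 z) / a)"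
  have "Q holomorphic_on UNIV"
    unfolding Q_def
    by (intro holomorphic_on_divide holomorphic_on_mult holomorphic_on_diff holomorphic_on_power
          holomorphic_on_const holomorphic_deriv[OF f_entire open_UNIV] E_entire f_entire M1(1) a_nz)
  moreover have "Q z * f z = deriv f z * (E z - b / a)" for z
  proof -
    have "E z * f z ^ e * f z - M1 z * f z = a * E z - b"
      using E_eq[of z] unfolding M1(2) e by (simp add: algebra_simps)
    moreover have "Q z * f z = deriv f z * (E z * f z ^ e * f z - M1 z * f z) / a"
      by (simp add: Q_def algebra_simps)
    ultimately have "Q z * f z = deriv f z * ((a * E z - b) / a)" by simp
    also have "(a * E z - b) / a = E z - b / a" using a_nz by (simp add: diff_divide_distrib)
    finally show ?thesis .
  qed
  ultimately show thesis by (rule that)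
qed

context
  fixes Q :: "complex \<Rightarrow> complex"
  assumes Q_entire: "Q holomorphic_on UNIV"
    and Q_eq: "\<And>z. Q z * f z = deriv f z * (E z - b / a)"
begin

lemma deriv_resc: "deriv (resc z) \<zeta> = deriv f (\<zeta> + z) / of_real (\<kappa> z)"
  using higher_deriv_compose_affine[OF f_entire, of 1 "1 / of_real (\<kappa> z)" 1 z \<zeta>]
  by (simp add: resc_def[abs_def])

text \<open>The defining equation of Q is linear in f, hence the normalisation drops out.\<close>

lemma Q_rescaled: "Q (\<zeta> + z) * resc z \<zeta> = deriv (resc z) \<zeta> * (E z * exp (\<alpha> * \<zeta>) - b / a)"
proof -
  have "Q (\<zeta> + z) * resc z \<zeta> = Q (\<zeta> + z) * f (\<zeta> + z) / of_real (\<kappa> z)" by (simp add: resc_def)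
  also have "\<dots> = deriv f (\<zeta> + z) * (E (\<zeta> + z) - b / a) / of_real (\<kappa> z)" by (simp only: Q_eq)
  finally show ?thesis by (simp add: deriv_resc E_translate)
qed

lemma exp_linear_entire_limit: "entire_limit (\<lambda>_ \<zeta>. exp (\<alpha> * \<zeta>)) (\<lambda>\<zeta>. exp (\<alpha> * \<zeta>))"
  by (intro entire_limit_id holomorphic_intros)

lemma limit_eq_of_E_convergent:
  assumes g: "entire_limit (\<lambda>i. resc (z i)) g" and s: "(\<lambda>i. inv_scale (z i)) \<longlonglongrightarrow> s"
    and L: "(\<lambda>i. E (z i)) \<longlonglongrightarrow> L"
  shows "M g \<zeta> - b * s ^ N = L * exp (\<alpha> * \<zeta>) * (g \<zeta> ^ N - a * s ^ N)"
proof -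
  note lim = rescaled_limit_functions[OF g s]
  have "(\<lambda>i. E (z i) * exp (\<alpha> * \<zeta>) * (resc (z i) \<zeta> ^ N - a * inv_scale (z i) ^ N)) \<longlonglongrightarrow>
      L * exp (\<alpha> * \<zeta>) * (g \<zeta> ^ N - a * s ^ N)"
    by (intro tendsto_mult L tendsto_const entire_limit_pointwise[OF lim(2)])
  then have "(\<lambda>i. M (resc (z i)) \<zeta> - b * inv_scale (z i) ^ N) \<longlonglongrightarrow>
      L * exp (\<alpha> * \<zeta>) * (g \<zeta> ^ N - a * s ^ N)"
    by (simp only: E_translate[symmetric] rescaled_eq)
  with entire_limit_pointwise[OF lim(1)] show ?thesis by (rule LIMSEQ_unique)
qed

lemma Q_eventually_bounded_of_E_convergent:
  assumes g: "entire_limit (\<lambda>i. resc (z i)) g" and s: "(\<lambda>i. inv_scale (z i)) \<longlonglongrightarrow> s"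
    "s = 0 \<Longrightarrow> cmod (g 0) = 1" and L: "(\<lambda>i. E (z i)) \<longlonglongrightarrow> L"
  shows "\<exists>B. eventually (\<lambda>i. cmod (Q (z i)) \<le> B) sequentially"
proof -
  \<comment> \<open>Here g is the limit of the denominators and must not vanish identically.
    Otherwise s \<noteq> 0 and b = a L exp (\<alpha> \<zeta>) for all \<zeta>, which fails on
    comparing 0 with 1 / \<alpha>.\<close>
  have "\<exists>w. g w \<noteq> 0"
  proof (rule ccontr)
    assume "\<not> ?thesis"
    then have g0: "g = (\<lambda>_. 0)" by auto
    then have "s \<noteq> 0" using s(2) by auto
    then have "b = a * L * exp (\<alpha> * \<zeta>)" for \<zeta>
      using limit_eq_of_E_convergent[OF g s(1) L, of \<zeta>] M_const[of 0 \<zeta>] N_pos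
      unfolding g0 by (simp add: zero_power mult_ac)
    from this[of 0] this[of "1 / \<alpha>"] have "b = b * exp 1" using \<alpha>_nz by simp
    then have "exp 1 = (1 :: complex)" using b_nz by simp
    then have "cmod (exp 1) = 1" by simp
    then show False by simp
  qed
  then obtain w where w: "g w \<noteq> 0" by blast
  have P: "entire_limit (\<lambda>i \<zeta>. deriv (resc (z i)) \<zeta> * (E (z i) * exp (\<alpha> * \<zeta>) - b / a))
      (\<lambda>\<zeta>. deriv g \<zeta> * (L * exp (\<alpha> * \<zeta>) - b / a))"
    by (intro entire_limit_mult entire_limit_diff entire_limit_deriv g entire_limit_const L tendsto_const
        exp_linear_entire_limit)
  obtain B where "eventually (\<lambda>i. cmod (Q (0 + z i)) \<le> B \<and>
      cmod (deriv (\<lambda>\<zeta>. Q (\<zeta> + z i)) 0) \<le> B) sequentially"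
    using entire_limit_quotient_bounded[OF P g translate_entire[OF Q_entire] Q_rescaled w] by blast
  then have "eventually (\<lambda>i. cmod (Q (z i)) \<le> B) sequentially" by eventually_elim simp
  then show ?thesis by blast
qed

text \<open>As \<open>E\<close> tends to infinity, \<open>f\<^sup>N - a\<close> tends to \<open>0\<close> like \<open>- b / E\<close>, also after
  differentiation. This determines the limit of \<open>Q\<close>.\<close>
lemma Q_limit_of_E_at_top:
  assumes g: "entire_limit (\<lambda>i. resc (z i)) g" and s: "(\<lambda>i. inv_scale (z i)) \<longlonglongrightarrow> s"
    "s = 0 \<Longrightarrow> cmod (g 0) = 1" and L: "filterlim (\<lambda>i. cmod (E (z i))) at_top sequentially"
  shows "(\<lambda>i. Q (z i)) \<longlonglongrightarrow> \<alpha> * b / (of_nat N * a)"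
proof -
  note lim = rescaled_limit_functions[OF g s(1)]
  define R where "R = (\<lambda>i \<zeta>. resc (z i) \<zeta> ^ N - a * inv_scale (z i) ^ N)"
  have inv: "(\<lambda>i. inverse (E (z i))) \<longlonglongrightarrow> 0"
    by (rule filterlim_compose[OF tendsto_inverse_0])
       (use L in \<open>simp add: filterlim_at_infinity_conv_norm_at_top\<close>)
  \<comment> \<open>Moving exp (\<alpha> \<zeta>) to the right leaves a factor independent of
    \<zeta> on the left, so differentiation acts on R alone.\<close>
  have ER: "E (z i) * R i \<zeta> = exp (- \<alpha> * \<zeta>) * (M (resc (z i)) \<zeta> - b * inv_scale (z i) ^ N)" for i \<zeta>
  proof -
    have "exp (- \<alpha> * \<zeta>) * exp (\<alpha> * \<zeta>) = 1" by (simp add: exp_add[symmetric])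
    then have "E (z i) = exp (- \<alpha> * \<zeta>) * E (\<zeta> + z i)" by (simp add: E_translate)
    then show ?thesis unfolding R_def rescaled_eq[symmetric] by (simp only: mult.assoc)
  qed
  have limER: "entire_limit (\<lambda>i \<zeta>. E (z i) * R i \<zeta>) (\<lambda>\<zeta>. exp (- \<alpha> * \<zeta>) * (M g \<zeta> - b * s ^ N))"
    unfolding ER by (intro entire_limit_mult entire_limit_id lim(1) holomorphic_intros)
  \<comment> \<open>E R converges and 1 / E tends to 0, so R tends to 0: this is the degenerate
    case.\<close>
  have eq: "g \<zeta> ^ N = a * s ^ N" for \<zeta>
  proof -
    have "(\<lambda>i. inverse (E (z i)) * (E (z i) * R i \<zeta>)) \<longlonglongrightarrow> 0 * (exp (- \<alpha> * \<zeta>) * (M g \<zeta> - b * s ^ N))"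
      by (intro tendsto_mult inv entire_limit_pointwise[OF limER])
    moreover have "inverse (E (z i)) * (E (z i) * R i \<zeta>) = R i \<zeta>" for i using E_nz by simp
    ultimately have "(\<lambda>i. R i \<zeta>) \<longlonglongrightarrow> 0" by simp
    then have "g \<zeta> ^ N - a * s ^ N = 0"
      using entire_limit_pointwise[OF lim(2), of \<zeta>] LIMSEQ_unique unfolding R_def by blast
    then show ?thesis by simp
  qed
  note c = limit_constant[OF entire_limitD(2)[OF g] s(2) eq]
  obtain \<gamma> where \<gamma>: "g = (\<lambda>_. \<gamma>)" using c(2) by blast
  \<comment> \<open>The derivative of R at 0, before multiplication by E.\<close>
  define D where "D = (\<lambda>i. of_nat N * (deriv (resc (z i)) 0 * resc (z i) 0 ^ (N - Suc 0)))"
  have dER: "deriv (\<lambda>\<zeta>. E (z i) * R i \<zeta>) 0 = E (z i) * D i" for i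
  proof -
    have "(resc (z i) has_field_derivative deriv (resc (z i)) 0) (at 0)"
      by (rule holomorphic_derivI[OF entire_limitD(1)[OF g] open_UNIV UNIV_I])
    from DERIV_cmult[OF DERIV_diff[OF DERIV_power[OF this, of N] DERIV_const], of "E (z i)"]
    have "((\<lambda>\<zeta>. E (z i) * R i \<zeta>) has_field_derivative E (z i) * D i) (at 0)"
      by (simp only: R_def D_def diff_zero)
    then show ?thesis by (rule DERIV_imp_deriv)
  qed
  have "deriv (\<lambda>\<zeta>. exp (- \<alpha> * \<zeta>) * (M g \<zeta> - b * s ^ N)) 0 = \<alpha> * b * s ^ N"
  proof -
    have "(\<lambda>\<zeta>. exp (- \<alpha> * \<zeta>) * (M g \<zeta> - b * s ^ N)) = (\<lambda>\<zeta>. exp (- \<alpha> * \<zeta>) * (0 - b * s ^ N))"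
      using c(3) by simp
    moreover have "((\<lambda>\<zeta>. exp (- \<alpha> * \<zeta>) * (0 - b * s ^ N)) has_field_derivative \<alpha> * b * s ^ N) (at 0)"
      by (auto intro!: derivative_eq_intros)
    ultimately show ?thesis by (simp only: DERIV_imp_deriv)
  qed
  then have ED: "(\<lambda>i. E (z i) * D i) \<longlonglongrightarrow> \<alpha> * b * s ^ N"
    using entire_limit_pointwise[OF entire_limit_deriv[OF limER], of 0] by (simp only: dER)
  have "(\<lambda>i. inverse (E (z i)) * (E (z i) * D i)) \<longlonglongrightarrow> 0 * (\<alpha> * b * s ^ N)"
    by (intro tendsto_mult inv ED)
  moreover have "(\<lambda>i. inverse (E (z i)) * (E (z i) * D i)) = D" by (simp add: E_nz mult.assoc[symmetric])
  ultimately have D0: "D \<longlonglongrightarrow> 0" by simp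
  have g0: "(\<lambda>i. resc (z i) 0 ^ N) \<longlonglongrightarrow> a * s ^ N"
    using entire_limit_pointwise[OF entire_limit_power[OF g, of N], of 0] by (simp only: eq)
  have as: "a * s ^ N \<noteq> 0" using c(1) a_nz by simp
  \<comment> \<open>Multiplied by N times the (N - 1)-st power of the translate, the equation for Q
    has right-hand side D (E - b / a). Here E D converges and D tends to 0; dividing by N a s^N
    \<noteq> 0 gives the limit of Q.\<close>
  have num: "of_nat N * (Q (z i) * resc (z i) 0 ^ N) = E (z i) * D i - b / a * D i" for i
  proof -
    obtain e where e: "N = Suc e" using gr0_implies_Suc[OF N_pos] by blast
    have "Q (z i) * resc (z i) 0 = deriv (resc (z i)) 0 * (E (z i) - b / a)"
      using Q_rescaled[of 0 "z i"] by simp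
    then have "Q (z i) * resc (z i) 0 ^ N = deriv (resc (z i)) 0 * (E (z i) - b / a) * resc (z i) 0 ^ e"
      unfolding e by (simp only: power_Suc mult.assoc[symmetric])
    moreover have "D i = of_nat N * (deriv (resc (z i)) 0 * resc (z i) 0 ^ e)"
      unfolding D_def by (simp only: e diff_Suc_Suc diff_zero)
    moreover have "c * (d * (x - y) * p) = x * (c * (d * p)) - y * (c * (d * p))" for c d x y p :: complex
      by (simp add: algebra_simps)
    ultimately show ?thesis by presburger
  qed
  have "(\<lambda>i. E (z i) * D i - b / a * D i) \<longlonglongrightarrow> \<alpha> * b * s ^ N - b / a * 0"
    by (intro tendsto_diff ED tendsto_mult tendsto_const D0)
  then have "(\<lambda>i. (of_nat N * (Q (z i) * resc (z i) 0 ^ N)) / (of_nat N * resc (z i) 0 ^ N)) \<longlonglongrightarrow>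
      (\<alpha> * b * s ^ N - b / a * 0) / (of_nat N * (a * s ^ N))"
    unfolding num
    by (intro tendsto_divide tendsto_mult tendsto_const g0 no_zero_divisors of_nat_N_nz ED tendsto_diff D0)
       (use a_nz c(1) in auto)
  moreover have "(\<alpha> * b * s ^ N - b / a * 0) / (of_nat N * (a * s ^ N)) = \<alpha> * b / (of_nat N * a)"
  proof -
    have "(\<alpha> * b * x - b / a * 0) / (d * (a * x)) = \<alpha> * b / (d * a)" if "x \<noteq> 0" for x d by (use that in simp)
    then show ?thesis using c(1) by (metis power_not_zero)
  qed
  moreover have "eventually (\<lambda>i. (of_nat N * (Q (z i) * resc (z i) 0 ^ N)) / (of_nat N * resc (z i) 0 ^ N) = Q (z i)) sequentially"
  proof -
    have "eventually (\<lambda>i. resc (z i) 0 ^ N \<noteq> 0) sequentially"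
      by (rule tendsto_imp_eventually_ne[OF g0 as])
    then show ?thesis
    proof eventually_elim
      case (elim i)
      then show ?case using of_nat_N_nz by (simp del: of_nat_add power_eq_0_iff of_nat_eq_0_iff)
    qed
  qed
  ultimately show ?thesis using Lim_transform_eventually by simp
qed

lemma Q_bounded: "bounded (range Q)"
proof (rule ccontr)
  assume "\<not> ?thesis"
  then have "\<exists>w. cmod (Q w) > real i" for i unfolding bounded_iff by (auto simp: not_le)
  then obtain z where z: "\<And>i. cmod (Q (z i)) > real i" by metis
  have no_bound: False if "strict_mono r" "eventually (\<lambda>i. cmod (Q (z (r i))) \<le> B) sequentially" for r B
  proof -
    obtain j where j: "real j > B" using reals_Archimedean2 by blast
    have "eventually (\<lambda>i. i \<ge> j) sequentially" by (rule eventually_ge_at_top)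
    with that(2) have "eventually (\<lambda>i. False) sequentially"
    proof eventually_elim
      case (elim i)
      have "real j \<le> real (r i)" using elim(2) seq_suble[OF that(1), of i] by simp
      then show ?case using elim(1) z[of "r i"] j by simp
    qed
    then show False by simp
  qed
  obtain r g s where r: "strict_mono r" and g: "entire_limit (\<lambda>i. resc (z (r i))) g"
    and s: "(\<lambda>i. inv_scale (z (r i))) \<longlonglongrightarrow> s" "s = 0 \<Longrightarrow> cmod (g 0) = 1"
    by (rule rescaled_sequence[of z]) (rule that, assumption+)
  show False
  proof (rule subseq_convergent_or_at_top[of "\<lambda>i. E (z (r i))"])
    fix r' L assume r': "strict_mono r'" and L: "(\<lambda>i. E (z (r (r' i)))) \<longlonglongrightarrow> L"
    have g': "entire_limit (\<lambda>i. resc (z (r (r' i)))) g" by (rule entire_limit_subseq[OF g r'])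
    have s': "(\<lambda>i. inv_scale (z (r (r' i)))) \<longlonglongrightarrow> s"
      using LIMSEQ_subseq_LIMSEQ[OF s(1) r'] by (simp add: o_def)
    obtain B where "eventually (\<lambda>i. cmod (Q (z (r (r' i)))) \<le> B) sequentially"
      using Q_eventually_bounded_of_E_convergent[OF g' s' s(2) L] by blast
    then show False using no_bound[OF strict_mono_o[OF r r'], of B] by (simp add: o_def)
  next
    assume "filterlim (\<lambda>i. cmod (E (z (r i)))) at_top sequentially"
    from Q_limit_of_E_at_top[OF g s this] have "Bseq (\<lambda>i. Q (z (r i)))"
      by (rule convergent_imp_Bseq[OF convergentI])
    then obtain B where "\<And>i. cmod (Q (z (r i))) \<le> B" unfolding Bseq_def by blast
    then show False using no_bound[OF r always_eventually, of B] by blast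
  qed
qed

lemma Q_constant: "Q z = \<alpha> * b / (of_nat N * a)"
proof -
  obtain q where q: "\<And>z. Q z = q"
    using Liouville_theorem[OF Q_entire Q_bounded] by (auto simp: constant_on_def)
  \<comment> \<open>At these points |E| = exp i, so the limit for large E identifies the
    constant.\<close>
  define z where "z = (\<lambda>i::nat. (of_nat i - \<beta>) / \<alpha>)"
  have Ez: "cmod (E (z i)) = exp (real i)" for i using \<alpha>_nz by (simp add: E_exp_eq z_def)
  obtain r g s where r: "strict_mono r" and g: "entire_limit (\<lambda>i. resc (z (r i))) g"
    and s: "(\<lambda>i. inv_scale (z (r i))) \<longlonglongrightarrow> s" "s = 0 \<Longrightarrow> cmod (g 0) = 1"
    by (rule rescaled_sequence[of z]) (rule that, assumption+)
  have "filterlim (\<lambda>i. cmod (E (z (r i)))) at_top sequentially"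
    unfolding Ez
    by (intro filterlim_compose[OF exp_at_top] filterlim_compose[OF filterlim_real_sequentially]
          filterlim_subseq r)
  from Q_limit_of_E_at_top[OF g s this] show ?thesis by (simp add: q LIMSEQ_const_iff)
qed

lemma Q_contradiction: False
proof -
  \<comment> \<open>Now E = exp (- i) tends to 0, and the limit equation loses its E term.\<close>
  define z where "z = (\<lambda>i::nat. (- of_nat i - \<beta>) / \<alpha>)"
  have Ez: "E (z i) = exp (- of_nat i)" for i using \<alpha>_nz by (simp add: E_exp_eq z_def)
  obtain r g s where r: "strict_mono r" and g: "entire_limit (\<lambda>i. resc (z (r i))) g"
    and s: "(\<lambda>i. inv_scale (z (r i))) \<longlonglongrightarrow> s" "s = 0 \<Longrightarrow> cmod (g 0) = 1"
    by (rule rescaled_sequence[of z]) (rule that, assumption+)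
  have L: "(\<lambda>i. E (z (r i))) \<longlonglongrightarrow> 0"
  proof (rule tendsto_norm_zero_cancel)
    have "(\<lambda>i. exp (- real (r i))) \<longlonglongrightarrow> 0"
      by (intro filterlim_compose[OF exp_at_bot] filterlim_compose[OF filterlim_uminus_at_bot_at_top]
            filterlim_compose[OF filterlim_real_sequentially] filterlim_subseq r)
    then show "(\<lambda>i. cmod (E (z (r i)))) \<longlonglongrightarrow> 0" by (simp add: Ez)
  qed
  have Mg: "M g \<zeta> = b * s ^ N" for \<zeta>
    using limit_eq_of_E_convergent[OF g s(1) L, of \<zeta>] by simp
  define q where "q = \<alpha> * b / (of_nat N * a)"
  \<comment> \<open>This is -\<alpha>/N; the sign comes from E - b / a tending to -b / a.\<close>
  define l where "l = - q * a / b"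
  have l: "l \<noteq> 0" using \<alpha>_nz b_nz a_nz of_nat_N_nz unfolding l_def q_def by (simp only: divide_eq_0_iff mult_eq_0_iff neg_equal_0_iff_equal) simp
  have dg: "deriv g \<zeta> = l * g \<zeta>" for \<zeta>
  proof -
    have "(\<lambda>i. deriv (resc (z (r i))) \<zeta> * (E (z (r i)) * exp (\<alpha> * \<zeta>) - b / a)) \<longlonglongrightarrow>
        deriv g \<zeta> * (0 * exp (\<alpha> * \<zeta>) - b / a)"
      by (intro tendsto_mult tendsto_diff tendsto_const L entire_limit_pointwise[OF entire_limit_deriv[OF g]])
    then have "(\<lambda>i. q * resc (z (r i)) \<zeta>) \<longlonglongrightarrow> deriv g \<zeta> * (0 * exp (\<alpha> * \<zeta>) - b / a)"
      unfolding Q_rescaled[symmetric] Q_constant q_def .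
    moreover have "(\<lambda>i. q * resc (z (r i)) \<zeta>) \<longlonglongrightarrow> q * g \<zeta>"
      by (intro tendsto_mult tendsto_const entire_limit_pointwise[OF g])
    ultimately have "deriv g \<zeta> * (0 * exp (\<alpha> * \<zeta>) - b / a) = q * g \<zeta>" by (rule LIMSEQ_unique)
    then have h: "- (deriv g \<zeta> * (b / a)) = q * g \<zeta>" by simp
    have "deriv g \<zeta> * (b / a) = - q * g \<zeta>"
      unfolding minus_mult_left[symmetric] h[symmetric] by simp
    then show ?thesis using a_nz b_nz by (simp add: l_def field_simps)
  qed
  have "((\<lambda>\<zeta>. g \<zeta> * exp (- l * \<zeta>)) has_field_derivative 0) (at \<zeta>)" for \<zeta>
    using holomorphic_derivI[OF entire_limitD(2)[OF g] open_UNIV UNIV_I, of \<zeta>]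
    by (auto intro!: derivative_eq_intros simp: dg)
  then obtain \<gamma> where \<gamma>: "\<And>\<zeta>. g \<zeta> * exp (- l * \<zeta>) = \<gamma>"
    using has_field_derivative_zero_constant[of UNIV "\<lambda>\<zeta>. g \<zeta> * exp (- l * \<zeta>)"] by auto
  have "g \<zeta> = \<gamma> * exp (l * \<zeta>)" for \<zeta>
    unfolding \<gamma>[of \<zeta>, symmetric] by (simp add: mult.assoc exp_add[symmetric])
  then have geq: "g = (\<lambda>\<zeta>. \<gamma> * exp (l * \<zeta>))" by blast
  have "M g \<zeta> = exp_coeff l * (\<gamma> * exp (l * \<zeta>)) ^ N" for \<zeta> unfolding geq by (rule M_exp)
  with Mg have eq: "exp_coeff l * (\<gamma> * exp (l * \<zeta>)) ^ N = b * s ^ N" for \<zeta> by simp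
  \<comment> \<open>A zero limit would force s = 0, where the normalisation gives |g 0| = 1.\<close>
  have "\<gamma> \<noteq> 0"
  proof
    assume "\<gamma> = 0"
    then have "s = 0" using eq[of 0] N_pos b_nz by (simp add: zero_power)
    then show False using s(2) \<open>\<gamma> = 0\<close> by (simp add: geq)
  qed
  then have "exp_coeff l * \<gamma> ^ N \<noteq> 0" using l exp_coeff_eq_0_iff by simp
  \<comment> \<open>The constancy of M g is tested at 1 / l and at 0, which gives exp N = 1.\<close>
  moreover have "exp_coeff l * \<gamma> ^ N * exp 1 ^ N = exp_coeff l * \<gamma> ^ N * 1"
  proof -
    have "l * (1 / l) = 1" using l by simp
    then show ?thesis
      using trans[OF eq[of "1 / l"] eq[of 0, symmetric]]
      by (simp only: mult_zero_right exp_zero power_mult_distrib power_one mult.assoc)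
  qed
  ultimately have "exp 1 ^ N = (1 :: complex)" by (rule mult_left_cancel[THEN iffD1])
  then have "cmod (exp 1) ^ N = 1" by (simp only: norm_power[symmetric] norm_one)
  then have "exp (1::real) ^ N = 1" by simp
  then show False using one_less_power[of "exp (1::real)" N] N_pos by simp
qed

end

end

section \<open>Constancy of the quotient and the case of equal values\<close>

lemma E_constant: obtains c where "c \<noteq> 0" "\<And>z. E z = c"
proof -
  obtain \<alpha> \<beta> where E: "\<And>z. E z = exp (\<alpha> * z + \<beta>)" using E_exp by blast
  have "\<alpha> = 0"
  proof (rule ccontr)
    assume \<alpha>: "\<alpha> \<noteq> 0"
    obtain Q where Q: "Q holomorphic_on UNIV" "\<And>z. Q z * f z = deriv f z * (E z - b / a)"
      by (rule Q_exists[OF E \<alpha>]) (rule that, assumption+)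
    show False by (rule Q_contradiction[OF E \<alpha> Q])
  qed
  then show thesis using that[of "exp \<beta>"] E by simp
qed

text \<open>Evaluating M f - a = c (f^N - a) at a zero of f gives c = 1, hence M f = f^N, which the
  vanishing orders forbid. So f is zero-free and, by its growth, an exponential; since f^N is not
  constant, coefficients can be compared.\<close>

lemma exponential_solution:
  assumes ab: "a = b"
  obtains c l where "c \<noteq> 0" "l \<noteq> 0" "\<And>z. f z = c * exp (l * z)" "exp_coeff l = 1"
proof -
  obtain c where c: "c \<noteq> 0" "\<And>z. E z = c" using E_constant by blast
  have Mc: "M f z - a = c * (f z ^ N - a)" for z using E_eq[of z] c(2) ab by simp
  have nz: "f z \<noteq> 0" for z
  proof
    assume z: "f z = 0"
    then have "c = 1" using Mc[of z] M_zero[OF f_entire z] a_nz N_pos by (simp add: zero_power)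
    then show False using M_neq_power[OF f_entire f_nonconst z] Mc by simp
  qed
  obtain K where K: "K \<ge> 0" "\<And>\<zeta>. cmod (f \<zeta>) = 1 \<Longrightarrow> cmod (deriv f \<zeta>) \<le> K"
    using level_deriv_bound by blast
  have bound: "cmod (f z) \<le> max 1 (cmod (f 0)) * exp (8 * K * cmod z)" for z
    using entire_growth_of_level_deriv_bound[OF f_entire K(2) K(1), of z 0] by simp
  have "0 \<le> 8 * K" using K(1) by simp
  from nonvanishing_entire_exponential_type[OF f_entire nz bound this]
  obtain l m where lm: "\<And>z. f z = exp (l * z + m)" by blast
  have l: "l \<noteq> 0" using f_nonconst lm by (auto simp: constant_on_def)
  have feq: "f = (\<lambda>z. exp m * exp (l * z))" by (rule ext) (simp only: lm exp_add mult.commute)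
  have "exp_coeff l * f z ^ N - a = c * (f z ^ N - a)" for z
    using Mc[of z] M_exp[of "exp m" l z] unfolding feq by simp
  then have lin: "(exp_coeff l - c) * f z ^ N = a - c * a" for z by (simp add: algebra_simps)
  have "exp_coeff l = c"
  proof (rule ccontr)
    assume "exp_coeff l \<noteq> c"
    then have "f z ^ N = (a - c * a) / (exp_coeff l - c)" for z
      using lin[of z] by (simp add: eq_divide_eq mult.commute)
    from entire_power_const_imp_const[OF f_entire this N_pos] show False using f_nonconst by blast
  qed
  moreover from this have "c = 1" using lin[of 0] a_nz by simp
  ultimately show thesis using that[of "exp m" l] l feq by simp
qed

end

theorem theorem2:
  fixes f :: "complex \<Rightarrow> complex" and a b :: complex
    and n k :: nat and ns ts :: "nat \<Rightarrow> nat"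
  assumes "k \<ge> 1"
    and "\<And>j. j \<in> {1..k} \<Longrightarrow> ns j \<ge> 1"
    and "\<And>j. j \<in> {1..k} \<Longrightarrow> ts j \<ge> 1"
    and "(k = 1 \<and> n = 0 \<and> ns 1 \<ge> ts 1 + 1) \<or>
         ((n \<ge> 1 \<or> k \<ge> 2) \<and> (\<forall>j\<in>{1..k}. ns j \<ge> ts j) \<and>
          n + (\<Sum>j=1..k. ns j) \<ge> (\<Sum>j=1..k. ts j) + 2)"
    and "a \<noteq> 0" and "b \<noteq> 0"
    and "f holomorphic_on UNIV" and "\<not> f constant_on UNIV"
    and "(\<lambda>z. f z ^ (n + (\<Sum>j=1..k. ns j)) - a) \<rightleftharpoons> (\<lambda>z. diff_monomial n k ns ts f z - b)"
  shows "(\<exists>c. c \<noteq> 0 \<and>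
            (\<forall>z. f z ^ (n + (\<Sum>j=1..k. ns j)) - a \<noteq> 0 \<longrightarrow>
               (diff_monomial n k ns ts f z - b) / (f z ^ (n + (\<Sum>j=1..k. ns j)) - a) = c)) \<and>
         (a = b \<longrightarrow>
            (\<exists>c\<^sub>1 t. c\<^sub>1 \<noteq> 0 \<and> t \<noteq> 0 \<and> (\<forall>z. f z = c\<^sub>1 * exp (t * z)) \<and>
               (\<Prod>j=1..k. (t * of_nat (ns j)) ^ ts j) = 1))"
proof -
  interpret shared_value n k ns ts f a b
  proof
    show "ts j \<le> ns j" if "j \<in> {1..k}" for j using assms(4) that by auto
    show "(\<Sum>j=1..k. ts j) < n + (\<Sum>j=1..k. ns j)" using assms(4) by auto
  qed (use assms in auto)
  \<comment> \<open>f^N is not identically a, so its a-points are isolated and the quotient E can be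
    formed.\<close>
  obtain w where w: "f w ^ N - a \<noteq> 0"
    using entire_power_const_imp_const[OF f_entire _ N_pos, of a] f_nonconst by auto
  obtain E where E: "E holomorphic_on UNIV" "\<And>z. E z \<noteq> 0" "\<And>z. M f z - b = E z * (f z ^ N - a)"
    by (rule same_zeros_entire_quotient[OF F_entire G_entire shared w]) (rule that, assumption+)
  interpret shared_quotient n k ns ts f a b E
    by unfold_locales (use E in auto)
  obtain c where c: "c \<noteq> 0" "\<And>z. E z = c" using E_constant by blast
  show ?thesis
  proof (intro conjI impI)
    show "\<exists>c. c \<noteq> 0 \<and> (\<forall>z. f z ^ N - a \<noteq> 0 \<longrightarrow> (M f z - b) / (f z ^ N - a) = c)"
      using c E(3) by auto
    show "\<exists>c\<^sub>1 t. c\<^sub>1 \<noteq> 0 \<and> t \<noteq> 0 \<and> (\<forall>z. f z = c\<^sub>1 * exp (t * z)) \<and>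
        (\<Prod>j=1..k. (t * of_nat (ns j)) ^ ts j) = 1" if ab: "a = b"
    proof -
      obtain c l where "c \<noteq> 0" "l \<noteq> 0" "\<And>z. f z = c * exp (l * z)" "exp_coeff l = 1"
        using exponential_solution[OF ab] by blast
      then show ?thesis unfolding exp_coeff_def by blast
    qed
  qed
qed

end
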